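(* Let $\{Y_t\}_{t\in\mathbb Z}$ be an $\mathbb R^p$-valued random sequence generated by $$Y_t=AY_{t-1}+H(Y_{t-1})E_t,$$ where $A\in\mathbb R^{p\times p}$, $H:\mathbb R^p\to\mathbb R^{p\times p}$ is a matrix-valued function, and $\{E_t\}_{t\in\mathbb Z}$ is a sequence of independent random vectors such that $$\sup_{t\in\mathbb Z}\sup_{u\in\mathbb S^{p-1}}\|u^{\mathsf T}E_t\|_{\psi_2}\le\kappa_1'\quad\text{and}\quad\sup_{t\in\mathbb Z}\sup_{v\in\bar{\mathbb S}^{p-1}}\|v^{\mathsf T}E_t\|_{\psi_2}\le\kappa_*'$$ for some constants $0<\kappa_1',\kappa_*'<\infty$. Assume $\|A\|\le a_1$ and $$\|H(u)-H(v)\|\le\frac{a_2}{\kappa_*'}\|u-v\|_2\quad\text{for all }u,v\in\mathbb R^p,$$ for some universal constants $a_1<1$, $a_2>0$ with $a_1+a_2<1$. Put $$\kappa_1:=\sup_{t\in\mathbb Z}\sup_{u\in\mathbb S^{p-1}}\|u^{\mathsf T}Y_t\|_{\psi_2},\qquad \kappa_*:=\sup_{t\in\mathbb Z}\sup_{v\in\bar{\mathbb S}^{p-1}}\|v^{\mathsf T}Y_t\|_{\psi_2}.$$ If $\kappa_1<\infty$ and $\kappa_*<\infty$, then, with $$\gamma_1=C\frac{\kappa_*}{\kappa_1},\quad\gamma_2=-\log(a_1+a_2),\quad\gamma_3=C'\max\Big(\frac{\kappa_*\kappa_1'}{\kappa_1\kappa_*'},1\Big),\quad\gamma_4=\log\big((a_1+a_2)^{-1}\big)$$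 for some constants $C,C'>0$ depending only on $\epsilon$, the following two conditions hold. First, for any integer $j$ there is a sequence of random vectors $\{\tilde Y_t\}_{t>j}$ which is independent of $\sigma(\{Y_t\}_{t\le j})$, identically distributed as $\{Y_t\}_{t>j}$, and for any integer $k\ge j+1$, $$\big\|\,\|Y_k-\tilde Y_k\|_2\,\big\|_{L(1+\epsilon)}\le\gamma_1\kappa_1\exp\{-\gamma_2(k-j-1)\}.$$ Second, for any integer $j$ there is a sequence of random vectors $\{\tilde Y_t\}_{t>j}$ which is independent of $\sigma(\{Y_t\}_{t\le j})$, identically distributed as $\{Y_t\}_{t>j}$, and for any integer $k\ge j+1$, $$\sup_{u\in\mathbb S^{p-1}}\|(Y_k-\tilde Y_k)^{\mathsf T}u\|_{L(1+\epsilon)}\le\gamma_3\kappa_1\exp\{-\gamma_4(k-j-1)\}.$$ If one further assumes that $\{Y_t\}_{t\in\mathbb Z}$ is a stationary sequence and that $\sup_{u\in\mathbb R^p}\|H(u)\|<D_2$ for some universal constant $D_2<\infty$, then $\kappa_1<\infty$ and $\kappa_*<\infty$ (so that finiteness of $\kappa_1$ and $\kappa_*$ need not be assumed in this case).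
   Context: Notation. $\|\cdot\|$ is the spectral norm of matrices, $\|\cdot\|_2$ the Euclidean norm of vectors. For a real random variable $X$: $\|X\|_{L(q)}:=(\mathbb E|X|^q)^{1/q}$ and $\|X\|_{\psi_2}:=\inf\{k\in(0,\infty):\mathbb E[\exp\{(|X|/k)^2\}-1]\le1\}$. $\mathbb S^{p-1}:=\{x\in\mathbb R^p:\|x\|_2=1\}$, $\bar{\mathbb S}^{p-1}:=\{x\in\mathbb R^p:|x_1|=\dots=|x_p|=1\}$. Here $\epsilon>0$ is a constant, the same in both coupling conditions of the claim.
   Formalization: The claim is proved for every ε with 0 < ε ≤ 4, not for every ε > 0: at ε = 5 it fails (p=1, A=0, a₂=2/5, H(u)=a₂(u+1), E_t=2 with probability 1/(e⁴−1), else 0). The sequence Ỹ lives on an extension of the probability space. *)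

theory Defs
  imports "HOL-Probability.Probability"
begin

text \<open>
  The dimension \<open>p\<close> has to be quantified after the constants \<open>C\<close> and \<open>C'\<close>, so it cannot be a type.
  Vectors in \<open>p\<close>-dimensional space are the elements of \<open>{..<p} \<rightarrow>\<^sub>E UNIV\<close>, i.e.\ the points of the
  product measurable space below; the Euclidean norm of \<open>x\<close> is \<open>L2_set x {..<p}\<close>. Matrices are
  functions \<open>nat \<Rightarrow> nat \<Rightarrow> real\<close> of which only the entries with indices below \<open>p\<close> are ever used.
\<close>

abbreviation vec_borel :: "nat \<Rightarrow> (nat \<Rightarrow> real) measure" where
  "vec_borel p \<equiv> PiM {..<p} (\<lambda>_. borel)"

abbreviation vecs :: "nat \<Rightarrow> (nat \<Rightarrow> real) set" where
  "vecs p \<equiv> {..<p} \<rightarrow>\<^sub>E UNIV"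

definition inner_vec :: "nat \<Rightarrow> (nat \<Rightarrow> real) \<Rightarrow> (nat \<Rightarrow> real) \<Rightarrow> real" where
  "inner_vec p x y = (\<Sum>i<p. x i * y i)"

definition mat_vec :: "nat \<Rightarrow> (nat \<Rightarrow> nat \<Rightarrow> real) \<Rightarrow> (nat \<Rightarrow> real) \<Rightarrow> nat \<Rightarrow> real" where
  "mat_vec p A x = (\<lambda>i\<in>{..<p}. \<Sum>j<p. A i j * x j)"

definition unit_sphere :: "nat \<Rightarrow> (nat \<Rightarrow> real) set" where
  "unit_sphere p = {u \<in> vecs p. L2_set u {..<p} = 1}"

definition sign_vectors :: "nat \<Rightarrow> (nat \<Rightarrow> real) set" where
  "sign_vectors p = {v \<in> vecs p. \<forall>i<p. \<bar>v i\<bar> = 1}"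

definition spectral_norm :: "nat \<Rightarrow> (nat \<Rightarrow> nat \<Rightarrow> real) \<Rightarrow> real" where
  "spectral_norm p A = (SUP u\<in>unit_sphere p. L2_set (mat_vec p A u) {..<p})"

text \<open>
  The coupling bounds are claimed in \<open>L(1 + \<epsilon>)\<close> with \<open>\<epsilon> \<le> 4\<close>: the decay rate \<open>a\<^sub>1 + a\<^sub>2\<close> needs
  \<open>lq_norm M (1 + \<epsilon>) X \<le> psi2_norm M X\<close>, and already for \<open>\<epsilon> = 5\<close> the bounds fail. Take
  \<open>p = 1\<close>, \<open>A = 0\<close>, \<open>\<kappa>\<^sub>1' = \<kappa>\<^sub>s' = 1\<close>, \<open>a\<^sub>1 = 0\<close>, \<open>a\<^sub>2 = 2/5\<close>, \<open>H u = a\<^sub>2 * (u + 1)\<close>, and i.i.d. \<open>E t\<close> equal to \<open>2\<close> with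
  probability \<open>1 / (exp 4 - 1)\<close> and to \<open>0\<close> otherwise.

  The norms of random variables take values in \<open>ennreal\<close> and are built from the nonnegative
  integral, so that a divergent expectation yields \<open>\<infinity>\<close> and not the value \<open>0\<close> of the Bochner
  integral; likewise the infimum of the empty set is \<open>\<infinity>\<close>.
\<close>

definition lq_norm :: "'b measure \<Rightarrow> real \<Rightarrow> ('b \<Rightarrow> real) \<Rightarrow> ennreal" where
  "lq_norm M q X =
    (let I = \<integral>\<^sup>+\<omega>. ennreal (\<bar>X \<omega>\<bar> powr q) \<partial>M
     in if I = \<infinity> then \<infinity> else ennreal (enn2real I powr (1 / q)))"

definition psi2_norm :: "'b measure \<Rightarrow> ('b \<Rightarrow> real) \<Rightarrow> ennreal" where
  "psi2_norm M X =
    Inf {ennreal k | k. 0 < k \<and> (\<integral>\<^sup>+\<omega>. ennreal (exp ((\<bar>X \<omega>\<bar> / k)\<^sup>2) - 1) \<partial>M) \<le> 1}"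

definition sup_psi2 ::
  "'b measure \<Rightarrow> nat \<Rightarrow> (nat \<Rightarrow> real) set \<Rightarrow> (int \<Rightarrow> 'b \<Rightarrow> nat \<Rightarrow> real) \<Rightarrow> ennreal" where
  "sup_psi2 M p S X = (SUP t. SUP u\<in>S. psi2_norm M (\<lambda>\<omega>. inner_vec p u (X t \<omega>)))"

text \<open>
  No relation between \<open>E t\<close> and the earlier values of \<open>Y\<close> is assumed beyond the recursion itself,
  which is required almost surely.
\<close>

locale nonlinear_ar = prob_space M
  for M :: "'a measure" +
  fixes p :: nat
    and A :: "nat \<Rightarrow> nat \<Rightarrow> real"
    and H :: "(nat \<Rightarrow> real) \<Rightarrow> nat \<Rightarrow> nat \<Rightarrow> real"
    and E Y :: "int \<Rightarrow> 'a \<Rightarrow> nat \<Rightarrow> real"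
    and a\<^sub>1 a\<^sub>2 \<kappa>\<^sub>1' \<kappa>\<^sub>s' :: real
  assumes dim_pos: "1 \<le> p"
    and Y_measurable: "\<And>t. Y t \<in> M \<rightarrow>\<^sub>M vec_borel p"
    and E_indep: "indep_vars (\<lambda>_. vec_borel p) E UNIV"
    and recursion: "\<And>t. AE \<omega> in M. \<forall>i<p.
          Y t \<omega> i = mat_vec p A (Y (t - 1) \<omega>) i + mat_vec p (H (Y (t - 1) \<omega>)) (E t \<omega>) i"
    and kappa_pos: "0 < \<kappa>\<^sub>1'" "0 < \<kappa>\<^sub>s'"
    and E_psi2_unit: "sup_psi2 M p (unit_sphere p) E \<le> ennreal \<kappa>\<^sub>1'"
    and E_psi2_sign: "sup_psi2 M p (sign_vectors p) E \<le> ennreal \<kappa>\<^sub>s'"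
    and A_norm: "spectral_norm p A \<le> a\<^sub>1"
    and H_lipschitz: "\<And>u v. u \<in> vecs p \<Longrightarrow> v \<in> vecs p \<Longrightarrow>
          spectral_norm p (\<lambda>i j. H u i j - H v i j) \<le> a\<^sub>2 / \<kappa>\<^sub>s' * L2_set (\<lambda>i. u i - v i) {..<p}"
    and contraction: "a\<^sub>1 < 1" "0 < a\<^sub>2" "a\<^sub>1 + a\<^sub>2 < 1"

definition stationary :: "'b measure \<Rightarrow> nat \<Rightarrow> (int \<Rightarrow> 'b \<Rightarrow> nat \<Rightarrow> real) \<Rightarrow> bool" where
  "stationary M p Y \<longleftrightarrow>
    (\<forall>h. distr M (PiM UNIV (\<lambda>_::int. vec_borel p)) (\<lambda>\<omega> t. Y (t + h) \<omega>)
       = distr M (PiM UNIV (\<lambda>_::int. vec_borel p)) (\<lambda>\<omega> t. Y t \<omega>))"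

text \<open>
  The coupled sequence is in general not definable on \<open>M\<close> itself, which may carry no randomness
  besides \<open>Y\<close>. As usual it lives on an extension \<open>N\<close> of \<open>M\<close>: a probability space on pairs with
  first marginal \<open>M\<close>, on which a random variable \<open>X\<close> on \<open>M\<close> is identified with \<open>X \<circ> fst\<close>.
\<close>

definition prob_extension :: "'a measure \<Rightarrow> ('a \<times> 'b) measure \<Rightarrow> bool" where
  "prob_extension M N \<longleftrightarrow> prob_space N \<and> fst \<in> N \<rightarrow>\<^sub>M M \<and> distr N M fst = M"

definition independent_copy_after ::
  "'b measure \<Rightarrow> nat \<Rightarrow> int \<Rightarrow> (int \<Rightarrow> 'b \<Rightarrow> nat \<Rightarrow> real) \<Rightarrow> (int \<Rightarrow> 'b \<Rightarrow> nat \<Rightarrow> real) \<Rightarrow> bool" where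
  "independent_copy_after N p j Y Y' \<longleftrightarrow>
    (\<forall>t>j. Y' t \<in> N \<rightarrow>\<^sub>M vec_borel p) \<and>
    prob_space.indep_var N
      (PiM {..j} (\<lambda>_. vec_borel p)) (\<lambda>\<omega>. \<lambda>t\<in>{..j}. Y t \<omega>)
      (PiM {j<..} (\<lambda>_. vec_borel p)) (\<lambda>\<omega>. \<lambda>t\<in>{j<..}. Y' t \<omega>) \<and>
    distr N (PiM {j<..} (\<lambda>_. vec_borel p)) (\<lambda>\<omega>. \<lambda>t\<in>{j<..}. Y' t \<omega>)
      = distr N (PiM {j<..} (\<lambda>_. vec_borel p)) (\<lambda>\<omega>. \<lambda>t\<in>{j<..}. Y t \<omega>)"

end

theory Submission
  imports Defs
begin

text \<open>
  A sub-Gaussian bound \<open>psi2_norm M X \<le> c\<close> gives \<open>lq_norm M q X \<le> c\<close> for \<open>1 \<le> q \<le> 5\<close>, because \<open>x ^ 5 \<le> exp (x\<^sup>2) - 1\<close>.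
  So one step of the recursion contracts in \<open>L(q)\<close> by the factor \<open>\<rho> = a\<^sub>1 + a\<^sub>2\<close>, once the noise is known to be
  independent of the past of \<open>Y\<close>. That independence is not assumed: it follows because the recursion, started
  from zero in the remote past, converges almost surely to \<open>Y t\<close>, which is therefore a function of the
  noise up to time \<open>t\<close>. The copy starts at time \<open>j\<close> from an independent copy of \<open>Y j\<close> and is driven by
  the same noise. The difference of the two sequences then has norm at most \<open>2 * \<kappa>\<^sub>s * \<rho> ^ n\<close> after \<open>n\<close> steps; its
  projections satisfy a similar recursion whose noise term is governed by \<open>\<kappa>\<^sub>1'\<close>. In the stationary case with bounded \<open>H\<close>,
  \<open>Y t\<close> is dominated by the geometric noise series \<open>\<Sum>k. a\<^sub>1 ^ k * D * \<parallel>E (t - k)\<parallel>\<close>, whose sub-Gaussian norm is finite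
  by convexity.
\<close>

section \<open>Moments and sub-Gaussian norms\<close>

text \<open>A comparison constant above 1 between the sub-Gaussian norm and \<open>L(q)\<close>
  would enter at every step, be raised to the power \<open>n\<close> and spoil the rate; hence the
  exact pointwise inequalities. A constant may be paid once, at time \<open>j\<close>, where
  \<open>Y j\<close> and the start of the copy are compared by the triangle inequality: this is the
  2 taken for both \<open>C\<close> and \<open>C'\<close>. The conditioning in each step is done by
  freezing the two states and integrating over the next noise vector, which works because the start
  of the copy lives on a second factor of a product space. The projected bound cannot be iterated
  alone: the change of \<open>H\<close> between the two states is controlled by their full Euclidean
  distance, so the Euclidean bound feeds into it, and the ratio
  \<open>\<kappa>\<^sub>s * \<kappa>\<^sub>1' / \<kappa>\<^sub>s'\<close> arises there. Causality is
  obtained from second moments, whatever \<open>\<epsilon>\<close> is. In the stationary case no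
  moment of \<open>Y\<close> is known in advance, so the domination by the noise series rests on the
  common law of all \<open>Y t\<close> and not on causality.\<close>

text \<open>Stated on \<open>q\<close>-th powers, so that neither the root nor the infinite case of
  \<open>lq_norm\<close> has to be handled before the end. The bound \<open>c = 0\<close> is
  meaningful: since \<open>0 powr q = 0\<close>, it makes a measurable \<open>X\<close> vanish
  almost surely.\<close>

definition lq_bounded :: "'b measure \<Rightarrow> real \<Rightarrow> ('b \<Rightarrow> real) \<Rightarrow> real \<Rightarrow> bool" where
  "lq_bounded M q X c \<longleftrightarrow> (\<integral>\<^sup>+\<omega>. ennreal (\<bar>X \<omega>\<bar> powr q) \<partial>M) \<le> ennreal (c powr q)"

lemma lq_norm_le:
  assumes "lq_bounded M q X c" "0 \<le> c" "0 < q"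
  shows "lq_norm M q X \<le> ennreal c"
proof -
  let ?I = "\<integral>\<^sup>+\<omega>. ennreal (\<bar>X \<omega>\<bar> powr q) \<partial>M"
  have I: "?I \<le> ennreal (c powr q)" using assms unfolding lq_bounded_def by simp
  hence fin: "?I \<noteq> \<infinity>" by (metis ennreal_less_top infinity_ennreal_def leD)
  have "enn2real ?I \<le> c powr q" using I by (simp add: enn2real_leI)
  hence "enn2real ?I powr (1/q) \<le> (c powr q) powr (1/q)" using assms by (intro powr_mono2) auto
  also have "\<dots> = c" using assms by (simp add: powr_powr)
  finally show ?thesis using fin unfolding lq_norm_def Let_def by (auto intro: ennreal_leI)
qed

lemma lq_bounded_mono:
  assumes "lq_bounded M q X c" "AE \<omega> in M. \<bar>Y \<omega>\<bar> \<le> \<bar>X \<omega>\<bar>" "0 \<le> q"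
  shows "lq_bounded M q Y c"
proof -
  have "(\<integral>\<^sup>+\<omega>. ennreal (\<bar>Y \<omega>\<bar> powr q) \<partial>M) \<le> (\<integral>\<^sup>+\<omega>. ennreal (\<bar>X \<omega>\<bar> powr q) \<partial>M)"
    using assms(2) by (intro nn_integral_mono_AE) (auto elim!: eventually_mono intro!: ennreal_leI powr_mono2 assms)
  thus ?thesis using assms(1) unfolding lq_bounded_def by order
qed

lemma lq_bounded_weaken:
  assumes "lq_bounded M q X c" "0 \<le> c" "c \<le> d" "0 \<le> q"
  shows "lq_bounded M q X d"
  using assms unfolding lq_bounded_def
  by (meson ennreal_leI order_trans powr_mono2)

lemma lq_bounded_mult:
  assumes "lq_bounded M q X c" "0 \<le> c" "X \<in> borel_measurable M"
  shows "lq_bounded M q (\<lambda>\<omega>. a * X \<omega>) (\<bar>a\<bar> * c)"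
proof -
  have "(\<integral>\<^sup>+\<omega>. ennreal (\<bar>a * X \<omega>\<bar> powr q) \<partial>M)
      = (\<integral>\<^sup>+\<omega>. ennreal (\<bar>a\<bar> powr q) * ennreal (\<bar>X \<omega>\<bar> powr q) \<partial>M)"
    by (simp add: abs_mult powr_mult ennreal_mult)
  also have "\<dots> = ennreal (\<bar>a\<bar> powr q) * (\<integral>\<^sup>+\<omega>. ennreal (\<bar>X \<omega>\<bar> powr q) \<partial>M)"
    using assms(3) by (intro nn_integral_cmult) measurable
  also have "\<dots> \<le> ennreal (\<bar>a\<bar> powr q) * ennreal (c powr q)"
    using assms(1) unfolding lq_bounded_def by (intro mult_left_mono) auto
  finally show ?thesis using assms(2) unfolding lq_bounded_def
    by (simp add: powr_mult ennreal_mult)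
qed

text \<open>The proofs of \<open>lq_bounded_add\<close> and \<open>lq_bounded_psi2\<close> divide by
  the bound, which may be 0, and the second also needs a number strictly above the infimum in
  \<open>psi2_norm\<close>. Both are run for all larger bounds and closed by this limit.\<close>

lemma lq_bounded_limit:
  assumes "\<And>k. c < k \<Longrightarrow> lq_bounded M q X k" "0 \<le> c" "0 < q"
  shows "lq_bounded M q X c"
proof -
  have "(\<lambda>n. (c + 1 / real (Suc n)) powr q) \<longlonglongrightarrow> (c + 0) powr q"
    using assms by (intro tendsto_powr2 tendsto_add tendsto_const LIMSEQ_Suc lim_1_over_n) auto
  hence "(\<lambda>n. ennreal ((c + 1 / real (Suc n)) powr q)) \<longlonglongrightarrow> ennreal (c powr q)"
    by (intro tendsto_ennrealI) simp
  moreover have "(\<integral>\<^sup>+\<omega>. ennreal (\<bar>X \<omega>\<bar> powr q) \<partial>M) \<le> ennreal ((c + 1 / real (Suc n)) powr q)" for n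
    using assms(1)[of "c + 1 / real (Suc n)"] unfolding lq_bounded_def by simp
  ultimately show ?thesis unfolding lq_bounded_def using LIMSEQ_le_const by blast
qed

text \<open>Convexity of \<open>powr\<close> is applied at positive points only; if \<open>x\<close>
  or \<open>y\<close> is 0, the claim reduces to \<open>s powr q \<le> s\<close> for
  \<open>s\<close> in the unit interval.\<close>

lemma convex_combination_powr_le:
  fixes x y l q :: real
  assumes "1 \<le> q" "0 \<le> x" "0 \<le> y" "0 \<le> l" "l \<le> 1"
  shows "((1 - l) * x + l * y) powr q \<le> (1 - l) * x powr q + l * y powr q"
proof -
  have le: "s powr q \<le> s" if "0 \<le> s" "s \<le> 1" for s :: real
    using powr_mono'[of 1 q s] that assms(1) by simp
  consider "x = 0" | "y = 0" | "0 < x" "0 < y" using assms by linarith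
  thus ?thesis
  proof cases
    case 1 then show ?thesis using assms le[of l] by (simp add: powr_mult mult_right_mono)
  next
    case 2 then show ?thesis using assms le[of "1-l"] by (simp add: powr_mult mult_right_mono)
  next
    case 3 then show ?thesis
      using convex_onD[OF powr_convex[OF assms(1)], of l x y] assms by simp
  qed
qed

text \<open>Minkowski's inequality, with \<open>Z\<close> merely dominated by the sum. For positive
  \<open>a\<close> and \<open>b\<close>, the sum \<open>x + y\<close> is \<open>a + b\<close> times
  a convex combination of \<open>x / a\<close> and \<open>y / b\<close>, and the powers of these two
  quotients integrate to at most 1.\<close>

lemma lq_bounded_add:
  assumes q: "1 \<le> q" and m: "X \<in> borel_measurable M" "Y \<in> borel_measurable M"
    and X: "lq_bounded M q X c" and Y: "lq_bounded M q Y d" and cd: "0 \<le> c" "0 \<le> d"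
    and Z: "AE \<omega> in M. \<bar>Z \<omega>\<bar> \<le> \<bar>X \<omega>\<bar> + \<bar>Y \<omega>\<bar>"
  shows "lq_bounded M q Z (c + d)"
proof -
  have pos: "lq_bounded M q Z (a + b)" if ab: "c < a" "d < b" for a b
  proof -
    have ab0: "0 < a" "0 < b" using ab cd by auto
    define l where "l = b / (a + b)"
    have l: "0 \<le> l" "l \<le> 1" "1 - l = a / (a + b)" using ab0 by (auto simp: l_def field_simps)
    have pw: "(x + y) powr q \<le> (a + b) powr q * ((1 - l) * (a powr - q * x powr q) + l * (b powr - q * y powr q))"
      if "0 \<le> x" "0 \<le> y" for x y
    proof -
      have "(1 - l) * (x / a) = x / (a + b)" "l * (y / b) = y / (a + b)"
        using ab0 unfolding l(3) by (auto simp: l_def)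
      hence "x + y = (a + b) * ((1 - l) * (x / a) + l * (y / b))"
        using ab0 by (simp flip: add_divide_distrib)
      hence "(x + y) powr q = (a + b) powr q * ((1 - l) * (x / a) + l * (y / b)) powr q"
        using ab0 that l by (simp add: powr_mult)
      also have "\<dots> \<le> (a + b) powr q * ((1 - l) * (x / a) powr q + l * (y / b) powr q)"
        using ab0 that l by (intro mult_left_mono convex_combination_powr_le q) auto
      also have "\<dots> = (a + b) powr q * ((1 - l) * (a powr - q * x powr q) + l * (b powr - q * y powr q))"
        using ab0 that by (simp add: powr_divide powr_minus_divide)
      finally show ?thesis .
    qed
    let ?c = "ennreal ((a + b) powr q)"
    have Z': "AE \<omega> in M. \<bar>Z \<omega>\<bar> powr q \<le> (a + b) powr q * ((1 - l) * (a powr - q * \<bar>X \<omega>\<bar> powr q) + l * (b powr - q * \<bar>Y \<omega>\<bar> powr q))"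
      using Z
    proof eventually_elim
      case (elim \<omega>)
      have "\<bar>Z \<omega>\<bar> powr q \<le> (\<bar>X \<omega>\<bar> + \<bar>Y \<omega>\<bar>) powr q" using elim q by (intro powr_mono2) auto
      also note pw
      finally show ?case by simp
    qed
    have "(\<integral>\<^sup>+\<omega>. ennreal (\<bar>Z \<omega>\<bar> powr q) \<partial>M) \<le> (\<integral>\<^sup>+\<omega>. ?c *
        (ennreal (1 - l) * (ennreal (a powr - q) * ennreal (\<bar>X \<omega>\<bar> powr q)) + ennreal l * (ennreal (b powr - q) * ennreal (\<bar>Y \<omega>\<bar> powr q))) \<partial>M)"
      using Z' l ab0 by (intro nn_integral_mono_AE)
        (auto elim!: eventually_mono intro!: ennreal_leI simp flip: ennreal_mult ennreal_plus)
    also have "\<dots> = ?c * (ennreal (1 - l) * (ennreal (a powr - q) * (\<integral>\<^sup>+\<omega>. ennreal (\<bar>X \<omega>\<bar> powr q) \<partial>M))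
        + ennreal l * (ennreal (b powr - q) * (\<integral>\<^sup>+\<omega>. ennreal (\<bar>Y \<omega>\<bar> powr q) \<partial>M)))"
      using m by (simp add: nn_integral_cmult nn_integral_add)
    also have "\<dots> \<le> ?c * (ennreal (1 - l) * (ennreal (a powr - q) * ennreal (a powr q))
        + ennreal l * (ennreal (b powr - q) * ennreal (b powr q)))"
    proof (intro mult_left_mono add_mono)
      show "(\<integral>\<^sup>+\<omega>. ennreal (\<bar>X \<omega>\<bar> powr q) \<partial>M) \<le> ennreal (a powr q)"
        using lq_bounded_weaken[OF X] ab q cd unfolding lq_bounded_def by auto
      show "(\<integral>\<^sup>+\<omega>. ennreal (\<bar>Y \<omega>\<bar> powr q) \<partial>M) \<le> ennreal (b powr q)"
        using lq_bounded_weaken[OF Y] ab q cd unfolding lq_bounded_def by auto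
    qed auto
    also have "\<dots> = ?c"
      using l ab0 by (simp flip: ennreal_mult ennreal_plus powr_add)
    finally show ?thesis unfolding lq_bounded_def .
  qed
  show ?thesis
  proof (rule lq_bounded_limit)
    fix k assume "c + d < k"
    thus "lq_bounded M q Z k" using pos[of "c + (k - c - d)/2" "d + (k - c - d)/2"] by (simp add: field_simps)
  qed (use cd q in auto)
qed

lemma nn_integral_lq_bounded_square:
  assumes "lq_bounded M 2 X c" "0 \<le> c"
  shows "(\<integral>\<^sup>+\<omega>. ennreal ((X \<omega>)\<^sup>2) \<partial>M) \<le> ennreal (c\<^sup>2)"
  using assms unfolding lq_bounded_def by (simp add: powr_numeral)

lemma product_le_weighted_squares:
  fixes a b r :: real
  assumes "0 < r"
  shows "a * b \<le> 1 / (2 * r) * a\<^sup>2 + r / 2 * b\<^sup>2"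
proof -
  have "0 \<le> (a - r * b)\<^sup>2" by simp
  thus ?thesis using assms by (simp add: field_simps power2_eq_square)
qed

lemma exp_square_convex:
  fixes x y l :: real
  assumes "0 \<le> l" "l \<le> 1"
  shows "exp (((1 - l) * x + l * y)\<^sup>2) - 1 \<le> (1 - l) * (exp (x\<^sup>2) - 1) + l * (exp (y\<^sup>2) - 1)"
proof -
  have "((1 - l) * x + l * y)\<^sup>2 \<le> (1 - l) * x\<^sup>2 + l * y\<^sup>2"
    using convex_onD[OF convex_power2, of l x y] assms by simp
  hence "exp (((1 - l) * x + l * y)\<^sup>2) \<le> exp ((1 - l) * x\<^sup>2 + l * y\<^sup>2)" by simp
  also have "\<dots> \<le> (1 - l) * exp (x\<^sup>2) + l * exp (y\<^sup>2)"
    using convex_onD[OF exp_convex, of l "x\<^sup>2" "y\<^sup>2"] assms by simp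
  finally show ?thesis by (simp add: algebra_simps)
qed

section \<open>Comparing powers with \<open>exp (x\<^sup>2) - 1\<close>\<close>

lemma exp_ge_partial_sum:
  fixes s :: real
  assumes "0 \<le> s"
  shows "1 + s + s^2/2 + s^3/6 + s^4/24 + s^5/120 \<le> exp s"
proof -
  have "(\<Sum>n<6. s^n /\<^sub>R fact n) \<le> (\<Sum>n. s^n /\<^sub>R fact n)"
    using assms summable_exp_generic[of s] by (intro sum_le_suminf) auto
  also have "(\<Sum>n<6. s^n /\<^sub>R fact n) = 1 + s + s^2/2 + s^3/6 + s^4/24 + s^5/120"
    by (simp only: lessThan_nat_numeral pred_numeral_simps BitM.simps arith_simps lessThan_Suc lessThan_0 fact_numeral) (simp add: fact_numeral field_simps)
  finally show ?thesis unfolding exp_def .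
qed

text \<open>With \<open>s = x\<^sup>2\<close>, the ratio \<open>x ^ 5 / (exp s - 1)\<close> is largest near \<open>s = 2.2\<close>. The half-power of \<open>s\<close> is
  removed by AM-GM with weight \<open>0.67\<close>, about \<open>1 / sqrt 2.2\<close>, and the remaining powers are replaced by their
  quadratic minorants at \<open>2.2\<close>.\<close>

lemma pow5_le_exp_square:
  fixes x :: real
  assumes "0 \<le> x"
  shows "x^5 \<le> exp (x^2) - 1"
proof -
  define s where "s = x^2"
  have s: "0 \<le> s" by (simp add: s_def)
  have "x * (67/100) \<le> ((67/100)^2 * s + 1) / 2"
    using zero_le_power2[of "x * (67/100) - 1"] by (simp add: s_def power2_eq_square algebra_simps)
  hence "s^2 * (x * (67/100)) \<le> s^2 * (((67/100)^2 * s + 1) / 2)" by (intro mult_left_mono) auto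
  hence 1: "s^2 * x \<le> s^2 * (67/200 * s + 100/134)" by (simp add: power2_eq_square algebra_simps)
  have a: "s^3 \<ge> 2 * (22/10) * s^2 - (22/10)^2 * s"
  proof -
    have "0 \<le> s * (s - 22/10)^2" using s by simp
    thus ?thesis by (simp add: power2_eq_square power3_eq_cube algebra_simps)
  qed
  have b: "s^4 \<ge> 2 * (22/10)^2 * s^2 - (22/10)^4"
  proof -
    have "0 \<le> (s^2 - (22/10)^2)^2" by simp
    thus ?thesis by (simp add: power2_eq_square power4_eq_xxxx algebra_simps)
  qed
  \<comment> \<open>Inserting \<open>a\<close> and \<open>b\<close> below leaves a quadratic with
    coefficients of about 0.805, -0.448 and 0.0957. The one here has them rounded down; its vertex
    is at \<open>45/19\<close>, where it is still positive.\<close>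
  have c: "0 \<le> 80/100 - 45/100 * s + 95/1000 * s^2"
  proof -
    have "0 \<le> (s - 45/19)^2" by simp
    thus ?thesis by (simp add: power2_eq_square algebra_simps)
  qed
  have "0 \<le> 1 + (1/2 - 100/134) * s + (1/6 - 67/200) * s^2 + s^3/24 + s^4/120"
    using a b c s by (simp add: power_divide) (use zero_le_power2[of s] in linarith) 
  hence "0 \<le> s * (1 + (1/2 - 100/134) * s + (1/6 - 67/200) * s^2 + s^3/24 + s^4/120)" using s by simp
  also have "\<dots> = (s + s^2/2 + s^3/6 + s^4/24 + s^5/120) - s^2 * (67/200 * s + 100/134)"
    by (simp add: eval_nat_numeral algebra_simps)
  also have "\<dots> \<le> exp s - 1 - s^2 * x"
    using exp_ge_partial_sum[OF s] 1 by linarith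
  also have "s^2 * x = x^5" by (simp add: s_def eval_nat_numeral)
  finally show ?thesis by (simp add: s_def)
qed

text \<open>Young's inequality interpolates between the exponents 0 and 5. The additive
  \<open>1 - q/5\<close> costs nothing on a probability space: if \<open>exp (x\<^sup>2) - 1\<close>
  integrates to at most 1, so does \<open>x powr q\<close>.\<close>

lemma powr_le_exp_square:
  fixes x q :: real
  assumes "0 \<le> x" "1 \<le> q" "q \<le> 5"
  shows "x powr q \<le> q/5 * (exp (x^2) - 1) + (1 - q/5)"
proof (cases "x = 0")
  case False
  hence x: "0 < x" using assms by simp
  have "x powr q = (x powr 5) powr (q/5) * 1 powr (1 - q/5)" by (simp only: powr_powr powr_one_eq_one) simp
  also have "\<dots> \<le> q/5 * x powr 5 + (1 - q/5) * 1"
    using x assms by (intro Youngs_inequality_0) auto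
  also have "\<dots> \<le> q/5 * (exp (x^2) - 1) + (1 - q/5)"
    using pow5_le_exp_square[of x] x assms by (simp add: powr_numeral)
  finally show ?thesis .
qed (use assms in auto)

section \<open>The sub-Gaussian norm and its moments\<close>

lemma psi2_norm_leI:
  assumes "0 < k" "(\<integral>\<^sup>+\<omega>. ennreal (exp ((\<bar>X \<omega>\<bar> / k)\<^sup>2) - 1) \<partial>M) \<le> 1"
  shows "psi2_norm M X \<le> ennreal k"
  unfolding psi2_norm_def using assms by (intro Inf_lower) auto

lemma psi2_norm_lessD:
  assumes "psi2_norm M X < ennreal k"
  shows "(\<integral>\<^sup>+\<omega>. ennreal (exp ((\<bar>X \<omega>\<bar> / k)\<^sup>2) - 1) \<partial>M) \<le> 1"
proof -
  obtain k' where k': "0 < k'" "ennreal k' < ennreal k"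
    "(\<integral>\<^sup>+\<omega>. ennreal (exp ((\<bar>X \<omega>\<bar> / k')\<^sup>2) - 1) \<partial>M) \<le> 1"
    using assms unfolding psi2_norm_def Inf_less_iff by auto
  hence "k' \<le> k" using ennreal_less_iff by fastforce
  hence "(\<integral>\<^sup>+\<omega>. ennreal (exp ((\<bar>X \<omega>\<bar> / k)\<^sup>2) - 1) \<partial>M) \<le> (\<integral>\<^sup>+\<omega>. ennreal (exp ((\<bar>X \<omega>\<bar> / k')\<^sup>2) - 1) \<partial>M)"
    using k'(1) by (intro nn_integral_mono ennreal_leI diff_right_mono) (auto intro!: power_mono divide_left_mono)
  thus ?thesis using k' by order
qed

lemma (in prob_space) lq_bounded_psi2:
  assumes q: "1 \<le> q" "q \<le> 5" and X: "X \<in> borel_measurable M"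
    and c: "psi2_norm M X \<le> ennreal c" "0 \<le> c"
  shows "lq_bounded M q X c"
proof (rule lq_bounded_limit)
  fix k assume k: "c < k"
  hence k0: "0 < k" using c by simp
  have "psi2_norm M X < ennreal k" using c k by (simp add: ennreal_lessI k0 order_le_less_trans)
  note I = psi2_norm_lessD[OF this]
  have "(\<integral>\<^sup>+\<omega>. ennreal (\<bar>X \<omega> / k\<bar> powr q) \<partial>M)
      \<le> (\<integral>\<^sup>+\<omega>. ennreal (q/5) * ennreal (exp ((\<bar>X \<omega>\<bar> / k)\<^sup>2) - 1) + ennreal (1 - q/5) \<partial>M)"
    using powr_le_exp_square[of "\<bar>X _ / k\<bar>" q] q k0
    by (intro nn_integral_mono) (auto simp flip: ennreal_mult ennreal_plus intro!: ennreal_leI)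
  also have "\<dots> = ennreal (q/5) * (\<integral>\<^sup>+\<omega>. ennreal (exp ((\<bar>X \<omega>\<bar> / k)\<^sup>2) - 1) \<partial>M) + ennreal (1 - q/5)"
    using X by (subst nn_integral_add) (auto simp: nn_integral_cmult emeasure_space_1)
  also have "\<dots> \<le> ennreal (q/5) * 1 + ennreal (1 - q/5)"
    using I by (intro add_mono mult_left_mono) auto
  also have "\<dots> = 1" using q by (simp flip: ennreal_plus)
  finally have "lq_bounded M q (\<lambda>\<omega>. X \<omega> / k) 1" unfolding lq_bounded_def by simp
  hence "lq_bounded M q (\<lambda>\<omega>. k * (X \<omega> / k)) (\<bar>k\<bar> * 1)" using X by (intro lq_bounded_mult) auto
  thus "lq_bounded M q X k" using k0 by simp
qed (use c q in auto)

lemma psi2_norm_le_sup_psi2: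
  assumes "u \<in> S"
  shows "psi2_norm M (\<lambda>\<omega>. inner_vec p u (X t \<omega>)) \<le> sup_psi2 M p S X"
  unfolding sup_psi2_def by (rule SUP_upper2[of t], simp, rule SUP_upper2[OF assms]) auto

section \<open>The Euclidean norm as an average over sign vectors\<close>

lemma finite_sign_vectors: "finite (sign_vectors p)"
  and sign_vectors_nonempty: "sign_vectors p \<noteq> {}"
proof -
  have "sign_vectors p = {..<p} \<rightarrow>\<^sub>E {-1, 1}"
    unfolding sign_vectors_def PiE_def Pi_def by (auto simp: abs_if split: if_splits)
  thus "finite (sign_vectors p)" "sign_vectors p \<noteq> {}" by (auto intro!: finite_PiE simp: PiE_eq_empty_iff)
qed

text \<open>Flipping the sign of coordinate \<open>i\<close> permutes the sign vectors and negates
  every summand when \<open>i\<close> and \<open>j\<close> differ, so the sum equals its own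
  negative.\<close>

lemma sum_sign_vectors_prod:
  assumes "i < p" "j < p"
  shows "(\<Sum>v\<in>sign_vectors p. v i * v j) = (if i = j then real (card (sign_vectors p)) else 0)"
proof (cases "i = j")
  case True
  have "v i * v i = 1" if "v \<in> sign_vectors p" for v
    using that assms abs_mult_self_eq[of "v i"] unfolding sign_vectors_def by auto
  thus ?thesis using True by simp
next
  case False
  let ?f = "\<lambda>v::nat \<Rightarrow> real. v(i := - v i)"
  have "(\<Sum>v\<in>sign_vectors p. v i * v j) = (\<Sum>v\<in>sign_vectors p. ?f v i * ?f v j)"
    by (rule sum.reindex_bij_witness[of _ ?f ?f])
      (use assms in \<open>auto simp: sign_vectors_def PiE_def extensional_def\<close>)
  also have "\<dots> = - (\<Sum>v\<in>sign_vectors p. v i * v j)"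
    using False by (simp add: sum_negf)
  finally show ?thesis using False by simp
qed

lemma sum_sign_vectors_square:
  "(\<Sum>v\<in>sign_vectors p. (inner_vec p v x)\<^sup>2) = real (card (sign_vectors p)) * (L2_set x {..<p})\<^sup>2"
proof -
  have "(\<Sum>v\<in>sign_vectors p. (inner_vec p v x)\<^sup>2)
      = (\<Sum>v\<in>sign_vectors p. \<Sum>i<p. \<Sum>j<p. (v i * v j) * (x i * x j))"
    unfolding inner_vec_def power2_eq_square sum_product by (simp add: mult_ac)
  also have "\<dots> = (\<Sum>i<p. \<Sum>j<p. (\<Sum>v\<in>sign_vectors p. v i * v j) * (x i * x j))"
    by (subst sum.swap, rule sum.cong[OF refl], subst sum.swap) (simp add: sum_distrib_right)
  also have "\<dots> = (\<Sum>i<p. \<Sum>j<p. if i = j then real (card (sign_vectors p)) * (x i * x i) else 0)"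
    by (intro sum.cong refl) (auto simp: sum_sign_vectors_prod)
  also have "\<dots> = real (card (sign_vectors p)) * (L2_set x {..<p})\<^sup>2"
    unfolding L2_set_def by (simp add: sum_nonneg sum_distrib_left power2_eq_square)
  finally show ?thesis .
qed

text \<open>The squared Euclidean norm is the average of the squared projections on the sign vectors,
  so Jensen's inequality applies to the exponential.\<close>

lemma psi2_norm_L2_set_le:
  assumes X: "X \<in> M \<rightarrow>\<^sub>M vec_borel p" and "0 \<le> c"
    and c: "\<And>v. v \<in> sign_vectors p \<Longrightarrow> psi2_norm M (\<lambda>\<omega>. inner_vec p v (X \<omega>)) \<le> ennreal c"
  shows "psi2_norm M (\<lambda>\<omega>. L2_set (X \<omega>) {..<p}) \<le> ennreal c"
\<comment> \<open>The slack \<open>e\<close> puts \<open>k\<close> strictly above all norms bounded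
  by \<open>c\<close>, as \<open>psi2_norm_lessD\<close> requires, and keeps it positive when
  \<open>c = 0\<close>.\<close>
proof (rule ennreal_le_epsilon)
  fix e :: real assume e: "0 < e"
  define k where "k = c + e"
  have k: "0 < k" "c < k" using e \<open>0 \<le> c\<close> by (auto simp: k_def)
  let ?S = "sign_vectors p" let ?w = "1 / real (card (sign_vectors p))"
  have card: "0 < card ?S" using finite_sign_vectors sign_vectors_nonempty by (simp add: card_gt_0_iff)
  have pw: "exp ((\<bar>L2_set x {..<p}\<bar> / k)\<^sup>2) - 1 \<le> (\<Sum>v\<in>?S. ?w * (exp ((\<bar>inner_vec p v x\<bar> / k)\<^sup>2) - 1))" for x
  proof -
    have "(\<bar>L2_set x {..<p}\<bar> / k)\<^sup>2 = (\<Sum>v\<in>?S. ?w *\<^sub>R (\<bar>inner_vec p v x\<bar> / k)\<^sup>2)"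
      using card by (simp add: power_divide sum_sign_vectors_square flip: sum_divide_distrib)
    also have "exp \<dots> \<le> (\<Sum>v\<in>?S. ?w * exp ((\<bar>inner_vec p v x\<bar> / k)\<^sup>2))"
      using card finite_sign_vectors sign_vectors_nonempty exp_convex
      by (intro convex_on_sum[where C=UNIV]) auto
    also have "\<dots> = (\<Sum>v\<in>?S. ?w * (exp ((\<bar>inner_vec p v x\<bar> / k)\<^sup>2) - 1)) + 1"
      using card by (simp add: sum_subtractf diff_divide_distrib)
    finally show ?thesis by simp
  qed
  have m: "(\<lambda>\<omega>. inner_vec p v (X \<omega>)) \<in> borel_measurable M" for v
    unfolding inner_vec_def
    by (intro borel_measurable_sum borel_measurable_times borel_measurable_const
      measurable_compose[OF X measurable_component_singleton]) auto
  have "(\<integral>\<^sup>+\<omega>. ennreal (exp ((\<bar>L2_set (X \<omega>) {..<p}\<bar> / k)\<^sup>2) - 1) \<partial>M)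
     \<le> (\<integral>\<^sup>+\<omega>. (\<Sum>v\<in>?S. ennreal ?w * ennreal (exp ((\<bar>inner_vec p v (X \<omega>)\<bar> / k)\<^sup>2) - 1)) \<partial>M)"
  proof (intro nn_integral_mono)
    fix \<omega>
    have "(\<Sum>v\<in>?S. ennreal ?w * ennreal (exp ((\<bar>inner_vec p v (X \<omega>)\<bar> / k)\<^sup>2) - 1))
        = ennreal (\<Sum>v\<in>?S. ?w * (exp ((\<bar>inner_vec p v (X \<omega>)\<bar> / k)\<^sup>2) - 1))"
      by (simp flip: ennreal_mult add: sum_ennreal)
    thus "ennreal (exp ((\<bar>L2_set (X \<omega>) {..<p}\<bar> / k)\<^sup>2) - 1)
        \<le> (\<Sum>v\<in>?S. ennreal ?w * ennreal (exp ((\<bar>inner_vec p v (X \<omega>)\<bar> / k)\<^sup>2) - 1))"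
      using pw by (simp only: ennreal_leI)
  qed
  also have "\<dots> = (\<Sum>v\<in>?S. ennreal ?w * (\<integral>\<^sup>+\<omega>. ennreal (exp ((\<bar>inner_vec p v (X \<omega>)\<bar> / k)\<^sup>2) - 1) \<partial>M))"
    using m by (simp add: nn_integral_sum nn_integral_cmult)
  also have "\<dots> \<le> (\<Sum>v\<in>?S. ennreal ?w * 1)"
  proof (intro sum_mono mult_left_mono psi2_norm_lessD)
    fix v assume "v \<in> ?S"
    thus "psi2_norm M (\<lambda>\<omega>. inner_vec p v (X \<omega>)) < ennreal k"
      using c k by (meson ennreal_lessI order_le_less_trans)
  qed auto
  also have "\<dots> = ennreal (\<Sum>v\<in>?S. ?w)" by (simp add: sum_ennreal del: sum_constant)
  also have "\<dots> = 1" using card by simp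
  finally have "psi2_norm M (\<lambda>\<omega>. L2_set (X \<omega>) {..<p}) \<le> ennreal k"
    using k by (intro psi2_norm_leI) auto
  thus "psi2_norm M (\<lambda>\<omega>. L2_set (X \<omega>) {..<p}) \<le> ennreal c + ennreal e"
    using e \<open>0 \<le> c\<close> by (simp add: k_def)
qed

section \<open>Matrices, measurability and independence\<close>

lemma L2_set_divide: "0 \<le> (c::real) \<Longrightarrow> L2_set (\<lambda>i. f i / c) A = L2_set f A / c"
  using L2_set_left_distrib[of "inverse c" f A] by (simp add: divide_inverse)

lemma L2_set_restrict [simp]: "L2_set (restrict x A) A = L2_set x A"
  by (rule L2_set_cong) auto

lemma L2_set_uminus: "L2_set (\<lambda>i. - f i) A = L2_set f A"
  by (simp add: L2_set_def)

lemma L2_set_diff_le: "L2_set (\<lambda>i. f i - g i) A \<le> L2_set f A + L2_set g A"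
  using L2_set_triangle_ineq[of f "\<lambda>i. - g i" A] by (simp add: L2_set_uminus)

lemma inner_vec_restrict [simp]: "inner_vec p (restrict x {..<p}) y = inner_vec p x y"
  by (simp add: inner_vec_def)

lemma abs_inner_vec_le: "\<bar>inner_vec p x y\<bar> \<le> L2_set x {..<p} * L2_set y {..<p}"
proof -
  have "\<bar>inner_vec p x y\<bar> \<le> (\<Sum>i<p. \<bar>x i\<bar> * \<bar>y i\<bar>)"
    unfolding inner_vec_def by (rule order_trans[OF sum_abs]) (simp add: abs_mult)
  also have "\<dots> \<le> L2_set x {..<p} * L2_set y {..<p}" by (rule L2_set_mult_ineq)
  finally show ?thesis .
qed

lemma normalized_in_unit_sphere:
  assumes "L2_set x {..<p} \<noteq> 0"
  shows "(\<lambda>i\<in>{..<p}. x i / L2_set x {..<p}) \<in> unit_sphere p"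
  using assms unfolding unit_sphere_def by (simp add: L2_set_divide)

text \<open>A supremum of reals is informative only over a bounded set; a crude entrywise bound is
  enough.\<close>

lemma bdd_above_spectral: "bdd_above ((\<lambda>u. L2_set (mat_vec p A u) {..<p}) ` unit_sphere p)"
proof (rule bdd_aboveI2)
  fix u assume u: "u \<in> unit_sphere p"
  have le: "\<bar>u j\<bar> \<le> 1" if "j < p" for j
    using member_le_L2_set[of "{..<p}" j "\<lambda>i. \<bar>u i\<bar>"] that u unfolding unit_sphere_def by (simp add: L2_set_def)
  have "L2_set (mat_vec p A u) {..<p} \<le> (\<Sum>i<p. \<bar>mat_vec p A u i\<bar>)" by (rule L2_set_le_sum_abs)
  also have "\<dots> \<le> (\<Sum>i<p. \<Sum>j<p. \<bar>A i j\<bar>)"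
  proof (rule sum_mono)
    fix i assume "i \<in> {..<p}"
    hence "\<bar>mat_vec p A u i\<bar> \<le> (\<Sum>j<p. \<bar>A i j * u j\<bar>)" by (simp add: mat_vec_def)
    also have "\<dots> \<le> (\<Sum>j<p. \<bar>A i j\<bar>)" using le by (intro sum_mono) (simp add: abs_mult mult_left_le)
    finally show "\<bar>mat_vec p A u i\<bar> \<le> (\<Sum>j<p. \<bar>A i j\<bar>)" .
  qed
  finally show "L2_set (mat_vec p A u) {..<p} \<le> (\<Sum>i<p. \<Sum>j<p. \<bar>A i j\<bar>)" .
qed

lemma L2_set_mat_vec_le: "L2_set (mat_vec p A x) {..<p} \<le> spectral_norm p A * L2_set x {..<p}"
proof (cases "L2_set x {..<p} = 0")
  case True
  hence "\<forall>i<p. x i = 0" by (simp add: L2_set_eq_0_iff)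
  thus ?thesis using True by (simp add: mat_vec_def L2_set_0')
next
  case False
  let ?n = "L2_set x {..<p}"
  let ?u = "\<lambda>i\<in>{..<p}. x i / ?n"
  have "L2_set (mat_vec p A x) {..<p} / ?n = L2_set (mat_vec p A ?u) {..<p}"
    by (subst L2_set_divide[symmetric])
      (auto intro!: L2_set_cong simp: mat_vec_def sum_divide_distrib)
  also have "\<dots> \<le> spectral_norm p A"
    unfolding spectral_norm_def
    using bdd_above_spectral normalized_in_unit_sphere[OF False] by (intro cSUP_upper)
  finally show ?thesis using False by (simp add: field_simps pos_divide_le_eq le_neq_trans)
qed

text \<open>Follows by testing on a basis vector. It yields nonnegativity of the spectral norm for
  \<open>1 \<le> p\<close>, and it makes every entry of \<open>H\<close> Lipschitz and hence
  measurable.\<close>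

lemma abs_entry_le_spectral_norm:
  assumes "i < p" "j < p"
  shows "\<bar>A i j\<bar> \<le> spectral_norm p A"
proof -
  define x :: "nat \<Rightarrow> real" where "x = (\<lambda>k. if k = j then 1 else 0)"
  have "mat_vec p A x i = A i j" using assms by (simp add: mat_vec_def x_def if_distrib sum.delta cong: if_cong)
  hence "\<bar>A i j\<bar> = \<bar>mat_vec p A x i\<bar>" by simp
  also have "\<dots> \<le> L2_set (\<lambda>i. \<bar>mat_vec p A x i\<bar>) {..<p}" using assms by (intro member_le_L2_set) auto
  also have "\<dots> = L2_set (mat_vec p A x) {..<p}" by (simp add: L2_set_def)
  also have "\<dots> \<le> spectral_norm p A * L2_set x {..<p}" by (rule L2_set_mat_vec_le)
  also have "(x k)\<^sup>2 = (if k = j then 1 else 0)" for k by (simp add: x_def)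
  hence "L2_set x {..<p} = 1" using assms by (simp add: L2_set_def)
  finally show ?thesis by simp
qed

lemma inner_vec_mat_vec:
  "inner_vec p u (mat_vec p A x) = inner_vec p (mat_vec p (\<lambda>i j. A j i) u) x"
proof -
  have "inner_vec p u (mat_vec p A x) = (\<Sum>i<p. \<Sum>j<p. u i * (A i j * x j))"
    by (simp add: inner_vec_def mat_vec_def sum_distrib_left)
  also have "\<dots> = (\<Sum>j<p. \<Sum>i<p. u i * (A i j * x j))" by (rule sum.swap)
  also have "\<dots> = inner_vec p (mat_vec p (\<lambda>i j. A j i) u) x"
    by (simp add: inner_vec_def mat_vec_def sum_distrib_left mult_ac)
  finally show ?thesis .
qed

lemma mat_vec_diff:
  "i < p \<Longrightarrow> mat_vec p (\<lambda>i j. B i j - B' i j) x i = mat_vec p B x i - mat_vec p B' x i"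
  "i < p \<Longrightarrow> mat_vec p B (\<lambda>i. x i - x' i) i = mat_vec p B x i - mat_vec p B x' i"
  by (simp_all add: mat_vec_def sum_subtractf algebra_simps)

lemma inner_vec_diff_right: "inner_vec p u (\<lambda>i. x i - y i) = inner_vec p u x - inner_vec p u y"
  by (simp add: inner_vec_def sum_subtractf algebra_simps)

text \<open>Let \<open>v\<close> be the transposed image of \<open>u\<close>. Its squared norm is
  the inner product of \<open>u\<close> with \<open>mat_vec p A v\<close>, so Cauchy-Schwarz bounds
  it by the norms of \<open>u\<close> and \<open>v\<close> times the spectral norm, and one factor
  cancels. If \<open>v\<close> has norm 0, nonnegativity of the spectral norm gives the
  claim.\<close>

lemma L2_set_mat_vec_transpose_le:
  assumes "1 \<le> p"
  shows "L2_set (mat_vec p (\<lambda>i j. A j i) u) {..<p} \<le> spectral_norm p A * L2_set u {..<p}"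
proof -
  let ?v = "mat_vec p (\<lambda>i j. A j i) u" let ?n = "L2_set ?v {..<p}"
  have nn: "0 \<le> spectral_norm p A" using abs_entry_le_spectral_norm[of 0 p 0 A] assms by simp
  have "?n * ?n = inner_vec p ?v ?v" by (simp add: L2_set_def inner_vec_def sum_nonneg power2_eq_square)
  also have "\<dots> = inner_vec p u (mat_vec p A ?v)" by (simp add: inner_vec_mat_vec)
  also have "\<dots> \<le> L2_set u {..<p} * L2_set (mat_vec p A ?v) {..<p}" using abs_inner_vec_le abs_le_D1 by blast
  also have "\<dots> \<le> L2_set u {..<p} * (spectral_norm p A * ?n)"
    by (intro mult_left_mono L2_set_mat_vec_le) auto
  finally have "?n * ?n \<le> (spectral_norm p A * L2_set u {..<p}) * ?n" by (simp add: mult_ac)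
  thus ?thesis using nn by (cases "?n = 0") (auto dest: mult_right_le_imp_le simp: less_le)
qed

section \<open>Measurability of vector-valued maps\<close>

lemma measurable_vec_component [measurable]:
  "X \<in> N \<rightarrow>\<^sub>M vec_borel p \<Longrightarrow> i < p \<Longrightarrow> (\<lambda>\<omega>. X \<omega> i) \<in> borel_measurable N"
  by (rule measurable_compose[OF _ measurable_component_singleton]) auto

lemma measurable_vecI:
  assumes "\<And>i. i < p \<Longrightarrow> (\<lambda>\<omega>. f \<omega> i) \<in> borel_measurable N"
  shows "(\<lambda>\<omega>. \<lambda>i\<in>{..<p}. f \<omega> i) \<in> N \<rightarrow>\<^sub>M vec_borel p"
  using assms by (intro measurable_restrict) auto

lemma measurable_L2_set_diff [measurable (raw)]:
  assumes "X \<in> N \<rightarrow>\<^sub>M vec_borel p" "Y \<in> N \<rightarrow>\<^sub>M vec_borel p"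
  shows "(\<lambda>\<omega>. L2_set (\<lambda>i. X \<omega> i - Y \<omega> i) {..<p}) \<in> borel_measurable N"
  unfolding L2_set_def using assms
  by (intro measurable_compose[OF _ borel_measurable_sqrt] borel_measurable_sum borel_measurable_power borel_measurable_diff) auto

lemma measurable_L2_set [measurable (raw)]:
  assumes "X \<in> N \<rightarrow>\<^sub>M vec_borel p"
  shows "(\<lambda>\<omega>. L2_set (X \<omega>) {..<p}) \<in> borel_measurable N"
  unfolding L2_set_def using assms
  by (intro measurable_compose[OF _ borel_measurable_sqrt] borel_measurable_sum borel_measurable_power) auto

lemma measurable_inner_vec [measurable (raw)]:
  assumes "X \<in> N \<rightarrow>\<^sub>M vec_borel p"
  shows "(\<lambda>\<omega>. inner_vec p u (X \<omega>)) \<in> borel_measurable N"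
  unfolding inner_vec_def using assms
  by (intro borel_measurable_sum borel_measurable_times) auto

text \<open>Measurability of \<open>H\<close> is not part of the locale and has to come from its
  Lipschitz condition. Precomposed with restriction, \<open>f\<close> is continuous in the product
  topology on all of \<open>nat \<Rightarrow> real\<close>, whose Borel sets are those of the full
  product space; padding by zeros maps the finite product into it measurably.\<close>

lemma borel_measurable_lipschitz_vec:
  fixes f :: "(nat \<Rightarrow> real) \<Rightarrow> real"
  assumes f: "\<And>u v. u \<in> vecs p \<Longrightarrow> v \<in> vecs p \<Longrightarrow> \<bar>f u - f v\<bar> \<le> c * L2_set (\<lambda>i. u i - v i) {..<p}"
  shows "f \<in> borel_measurable (vec_borel p)"
proof -
  define g where "g x = f (restrict x {..<p})" for x
  have g: "\<bar>g u - g v\<bar> \<le> c * L2_set (\<lambda>i. u i - v i) {..<p}" for u v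
    using f[of "restrict u {..<p}" "restrict v {..<p}"] by (simp add: g_def L2_set_def)
  have "(g \<longlongrightarrow> g x) (at x)" for x
  proof -
    have "continuous_on UNIV (\<lambda>y. c * L2_set (\<lambda>i. y i - x i) {..<p})"
      unfolding L2_set_def
      by (intro continuous_intros continuous_on_product_coordinates)
    hence "((\<lambda>y. c * L2_set (\<lambda>i. y i - x i) {..<p}) \<longlongrightarrow> c * L2_set (\<lambda>i. x i - x i) {..<p}) (at x)"
      unfolding continuous_on_def by blast
    hence "((\<lambda>y. c * L2_set (\<lambda>i. y i - x i) {..<p}) \<longlongrightarrow> 0) (at x)" by (simp add: L2_set_0')
    hence "((\<lambda>y. g y - g x) \<longlongrightarrow> 0) (at x)"
      by (rule Lim_null_comparison[rotated]) (use g in auto)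
    thus ?thesis by (rule LIM_zero_cancel)
  qed
  hence "continuous_on UNIV g" by (simp add: continuous_on_def)
  hence "g \<in> borel_measurable borel" by (rule borel_measurable_continuous_onI)
  hence "g \<in> borel_measurable (PiM UNIV (\<lambda>_. borel))"
    by (simp add: measurable_cong_sets[OF sets_PiM_equal_borel refl])
  moreover have "(\<lambda>x i. if i < p then x i else 0) \<in> vec_borel p \<rightarrow>\<^sub>M PiM UNIV (\<lambda>_. borel)"
  proof (rule measurable_PiM_single')
    show "(\<lambda>x. if i < p then x i else 0) \<in> borel_measurable (vec_borel p)" for i
      by (cases "i < p") (use measurable_component_singleton[of i "{..<p}" "\<lambda>_. borel :: real measure"] in auto)
  qed auto
  ultimately have "(\<lambda>x. g (\<lambda>i. if i < p then x i else 0)) \<in> borel_measurable (vec_borel p)"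
    by (rule measurable_compose[rotated])
  also have "?this \<longleftrightarrow> f \<in> borel_measurable (vec_borel p)"
  proof (rule measurable_cong)
    fix x assume "x \<in> space (vec_borel p)"
    hence "restrict (\<lambda>i. if i < p then x i else 0) {..<p} = x"
      by (auto simp: space_PiM PiE_def extensional_def)
    thus "g (\<lambda>i. if i < p then x i else 0) = f x" by (simp add: g_def)
  qed
  finally show ?thesis .
qed

lemma restrict_measurable_component:
  "s \<in> J \<Longrightarrow> (\<lambda>e. e s) \<in> PiM J (\<lambda>_. vec_borel p) \<rightarrow>\<^sub>M vec_borel p"
  by (rule measurable_component_singleton)

lemma zero_measurable: "(\<lambda>_. \<lambda>i\<in>{..<p}. 0) \<in> N \<rightarrow>\<^sub>M vec_borel p"
  by (rule measurable_vecI) auto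

lemma (in prob_space) lq_bounded_vec:
  assumes X: "X t \<in> M \<rightarrow>\<^sub>M vec_borel p" and c: "sup_psi2 M p (sign_vectors p) X \<le> ennreal c" "0 \<le> c"
    and q: "1 \<le> q" "q \<le> 5"
  shows "lq_bounded M q (\<lambda>\<omega>. L2_set (X t \<omega>) {..<p}) c"
proof (rule lq_bounded_psi2[OF q])
  show "psi2_norm M (\<lambda>\<omega>. L2_set (X t \<omega>) {..<p}) \<le> ennreal c"
    by (intro psi2_norm_L2_set_le X c(2) order_trans[OF psi2_norm_le_sup_psi2 c(1)])
qed (use X c in auto)

text \<open>Stated for any \<open>w\<close> and not only for unit vectors, because the recursion
  produces transposed images of a direction, and their lengths carry the contraction.\<close>

lemma (in prob_space) lq_bounded_projection:
  assumes X: "X t \<in> M \<rightarrow>\<^sub>M vec_borel p" and c: "sup_psi2 M p (unit_sphere p) X \<le> ennreal c" "0 \<le> c"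
    and q: "1 \<le> q" "q \<le> 5"
  shows "lq_bounded M q (\<lambda>\<omega>. inner_vec p w (X t \<omega>)) (L2_set w {..<p} * c)"
proof (cases "L2_set w {..<p} = 0")
  case True
  hence "\<forall>i<p. w i = 0" by (simp add: L2_set_eq_0_iff)
  thus ?thesis using True by (simp add: lq_bounded_def inner_vec_def)
next
  case False
  let ?n = "L2_set w {..<p}"
  let ?u = "\<lambda>i\<in>{..<p}. w i / ?n"
  have "lq_bounded M q (\<lambda>\<omega>. inner_vec p ?u (X t \<omega>)) c"
    using X c by (intro lq_bounded_psi2 q order_trans[OF psi2_norm_le_sup_psi2 c(1)] normalized_in_unit_sphere False) auto
  hence "lq_bounded M q (\<lambda>\<omega>. ?n * inner_vec p ?u (X t \<omega>)) (\<bar>?n\<bar> * c)"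
    using X c by (intro lq_bounded_mult) auto
  moreover have "?n * inner_vec p ?u x = inner_vec p w x" for x
    using False by (simp add: inner_vec_def sum_distrib_left)
  ultimately show ?thesis by simp
qed

section \<open>Fubini's theorem and null sets under independence\<close>

lemma (in prob_space) indep_var_nn_integral:
  assumes ind: "indep_var S X T Z" and f: "f \<in> borel_measurable (S \<Otimes>\<^sub>M T)"
  shows "(\<integral>\<^sup>+\<omega>. f (X \<omega>, Z \<omega>) \<partial>M) = (\<integral>\<^sup>+\<omega>. \<integral>\<^sup>+\<omega>'. f (X \<omega>, Z \<omega>') \<partial>M \<partial>M)"
proof -
  note rv = indep_var_rv1[OF ind] indep_var_rv2[OF ind]
  interpret Z: prob_space "distr M T Z" by (rule prob_space_distr) fact
  have eq: "distr M S X \<Otimes>\<^sub>M distr M T Z = distr M (S \<Otimes>\<^sub>M T) (\<lambda>x. (X x, Z x))"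
    using ind by (simp add: indep_var_distribution_eq)
  have f': "f \<in> borel_measurable (distr M S X \<Otimes>\<^sub>M distr M T Z)"
    using f by (simp add: measurable_cong_sets[OF sets_pair_measure_cong[OF sets_distr sets_distr] refl])
  have f'': "f \<in> borel_measurable (S \<Otimes>\<^sub>M distr M T Z)"
    using f by (simp add: measurable_cong_sets[OF sets_pair_measure_cong[OF refl sets_distr] refl])
  have "(\<integral>\<^sup>+\<omega>. f (X \<omega>, Z \<omega>) \<partial>M) = (\<integral>\<^sup>+x. f x \<partial>distr M (S \<Otimes>\<^sub>M T) (\<lambda>x. (X x, Z x)))"
    using rv f by (simp add: nn_integral_distr)
  also have "\<dots> = (\<integral>\<^sup>+x. \<integral>\<^sup>+z. f (x, z) \<partial>distr M T Z \<partial>distr M S X)"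
    unfolding eq[symmetric] using Z.nn_integral_fst[OF f'] by simp
  also have "\<dots> = (\<integral>\<^sup>+\<omega>. \<integral>\<^sup>+z. f (X \<omega>, z) \<partial>distr M T Z \<partial>M)"
    using rv Z.borel_measurable_nn_integral_fst[OF f''] by (intro nn_integral_distr) auto
  also have "\<dots> = (\<integral>\<^sup>+\<omega>. \<integral>\<^sup>+\<omega>'. f (X \<omega>, Z \<omega>') \<partial>M \<partial>M)"
    using rv f by (intro nn_integral_cong nn_integral_distr)
      (auto intro!: measurable_compose[OF _ f] dest: measurable_space)
  finally show ?thesis .
qed

text \<open>Independence is an identity between the joint law and the marginal laws, and laws ignore
  null sets.\<close>

lemma (in prob_space) indep_var_AE_cong:
  assumes ind: "indep_var S X T Z" and m: "X' \<in> M \<rightarrow>\<^sub>M S" "Z' \<in> M \<rightarrow>\<^sub>M T"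
    and ae: "AE \<omega> in M. X \<omega> = X' \<omega>" "AE \<omega> in M. Z \<omega> = Z' \<omega>"
  shows "indep_var S X' T Z'"
proof -
  note rv = indep_var_rv1[OF ind] indep_var_rv2[OF ind]
  have ae': "AE \<omega> in M. X' \<omega> = X \<omega>" "AE \<omega> in M. Z' \<omega> = Z \<omega>"
    using ae by (auto elim: eventually_mono)
  hence "distr M S X' = distr M S X" "distr M T Z' = distr M T Z"
    using rv m by (auto intro!: distr_cong_AE)
  moreover have "distr M (S \<Otimes>\<^sub>M T) (\<lambda>x. (X' x, Z' x)) = distr M (S \<Otimes>\<^sub>M T) (\<lambda>x. (X x, Z x))"
  proof (rule distr_cong_AE)
    show "AE x in M. (X' x, Z' x) = (X x, Z x)" using ae' by eventually_elim simp
  qed (use rv m in auto)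
  ultimately show ?thesis using ind m by (simp add: indep_var_distribution_eq)
qed

section \<open>The recursion as a deterministic map of a state and a noise path\<close>

context nonlinear_ar
begin

definition step :: "(nat \<Rightarrow> real) \<Rightarrow> (nat \<Rightarrow> real) \<Rightarrow> nat \<Rightarrow> real" where
  "step y e = (\<lambda>i\<in>{..<p}. mat_vec p A y i + mat_vec p (H y) e i)"

text \<open>The state at time \<open>j + n\<close> after a start from \<open>y\<close> at time
  \<open>j\<close>. The noise is read at the times \<open>j + 1\<close> to \<open>j + n\<close>
  only, so the noise at time \<open>j\<close> is not involved.\<close>

primrec traj :: "int \<Rightarrow> (nat \<Rightarrow> real) \<Rightarrow> (int \<Rightarrow> nat \<Rightarrow> real) \<Rightarrow> nat \<Rightarrow> nat \<Rightarrow> real" where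
  "traj j y e 0 = y"
| "traj j y e (Suc n) = step (traj j y e n) (e (j + int n + 1))"

lemma a1_nonneg: "0 \<le> a\<^sub>1"
  using abs_entry_le_spectral_norm[of 0 p 0 A] dim_pos A_norm by simp

lemma step_in_vecs: "step y e \<in> vecs p"
  by (simp add: step_def)

lemma traj_in_vecs: "y \<in> vecs p \<Longrightarrow> traj j y e n \<in> vecs p"
  by (induction n) (auto simp: step_in_vecs simp del: PiE_iff)

lemma traj_cong:
  assumes "\<And>s. j < s \<Longrightarrow> s \<le> j + int n \<Longrightarrow> e s = e' s"
  shows "traj j y e n = traj j y e' n"
  using assms by (induction n) auto

lemma H_entry_measurable: "i < p \<Longrightarrow> k < p \<Longrightarrow> (\<lambda>y. H y i k) \<in> borel_measurable (vec_borel p)"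
  by (rule borel_measurable_lipschitz_vec[where c = "a\<^sub>2 / \<kappa>\<^sub>s'"])
    (rule order_trans[OF abs_entry_le_spectral_norm[where A = "\<lambda>i j. H _ i j - H _ i j"] H_lipschitz])

lemma step_measurable [measurable (raw)]:
  assumes "f \<in> N \<rightarrow>\<^sub>M vec_borel p" "g \<in> N \<rightarrow>\<^sub>M vec_borel p"
  shows "(\<lambda>x. step (f x) (g x)) \<in> N \<rightarrow>\<^sub>M vec_borel p"
  unfolding step_def mat_vec_def
  using assms measurable_compose[OF assms(1) H_entry_measurable]
  by (intro measurable_vecI) auto

lemma traj_measurable:
  assumes "f \<in> N \<rightarrow>\<^sub>M vec_borel p"
    and "\<And>s. j < s \<Longrightarrow> s \<le> j + int n \<Longrightarrow> (\<lambda>x. g x s) \<in> N \<rightarrow>\<^sub>M vec_borel p"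
  shows "(\<lambda>x. traj j (f x) (g x) n) \<in> N \<rightarrow>\<^sub>M vec_borel p"
  using assms(2) by (induction n) (auto intro!: assms(1) step_measurable)

text \<open>A random Lipschitz constant for the map from one state to the next.\<close>

definition gain :: "(nat \<Rightarrow> real) \<Rightarrow> real" where
  "gain e = a\<^sub>1 + a\<^sub>2 / \<kappa>\<^sub>s' * L2_set e {..<p}"

lemma gain_nonneg: "0 \<le> gain e"
  using a1_nonneg contraction kappa_pos by (simp add: gain_def)

lemma step_diff:
  "i < p \<Longrightarrow> step y e i - step y' e i
    = mat_vec p A (\<lambda>i. y i - y' i) i + mat_vec p (\<lambda>i j. H y i j - H y' i j) e i"
  by (simp add: step_def mat_vec_diff)

lemma step_contraction:
  assumes "y \<in> vecs p" "y' \<in> vecs p"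
  shows "L2_set (\<lambda>i. step y e i - step y' e i) {..<p} \<le> gain e * L2_set (\<lambda>i. y i - y' i) {..<p}"
proof -
  let ?d = "L2_set (\<lambda>i. y i - y' i) {..<p}"
  have "L2_set (\<lambda>i. step y e i - step y' e i) {..<p}
      = L2_set (\<lambda>i. mat_vec p A (\<lambda>i. y i - y' i) i + mat_vec p (\<lambda>i j. H y i j - H y' i j) e i) {..<p}"
    by (intro L2_set_cong refl step_diff) auto
  also have "\<dots> \<le> L2_set (mat_vec p A (\<lambda>i. y i - y' i)) {..<p} + L2_set (mat_vec p (\<lambda>i j. H y i j - H y' i j) e) {..<p}"
    by (rule L2_set_triangle_ineq)
  also have "\<dots> \<le> spectral_norm p A * ?d + spectral_norm p (\<lambda>i j. H y i j - H y' i j) * L2_set e {..<p}"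
    by (intro add_mono L2_set_mat_vec_le)
  also have "\<dots> \<le> a\<^sub>1 * ?d + (a\<^sub>2 / \<kappa>\<^sub>s' * ?d) * L2_set e {..<p}"
    using A_norm H_lipschitz[OF assms] by (intro add_mono mult_right_mono) auto
  finally show ?thesis by (simp add: gain_def algebra_simps)
qed

lemma traj_contraction:
  assumes "y \<in> vecs p" "y' \<in> vecs p"
  shows "L2_set (\<lambda>i. traj j y e n i - traj j y' e n i) {..<p}
    \<le> (\<Prod>s\<in>{j<..j + int n}. gain (e s)) * L2_set (\<lambda>i. y i - y' i) {..<p}"
proof (induction n)
  case (Suc n)
  have "L2_set (\<lambda>i. traj j y e (Suc n) i - traj j y' e (Suc n) i) {..<p}
      \<le> gain (e (j + int n + 1)) * L2_set (\<lambda>i. traj j y e n i - traj j y' e n i) {..<p}"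
    using step_contraction traj_in_vecs assms by simp
  also have "\<dots> \<le> gain (e (j + int n + 1)) * ((\<Prod>s\<in>{j<..j + int n}. gain (e s)) * L2_set (\<lambda>i. y i - y' i) {..<p})"
    by (intro mult_left_mono Suc gain_nonneg)
  also have "\<dots> = (\<Prod>s\<in>insert (j + int n + 1) {j<..j + int n}. gain (e s)) * L2_set (\<lambda>i. y i - y' i) {..<p}"
    by (subst prod.insert) auto
  also have "insert (j + int n + 1) {j<..j + int n} = {j<..j + int (Suc n)}" by auto
  finally show ?case .
qed simp

lemma E_measurable [measurable]: "E t \<in> M \<rightarrow>\<^sub>M vec_borel p"
  using E_indep by (simp add: indep_vars_def)

declare Y_measurable [measurable]

lemma Y_in_vecs: "\<omega> \<in> space M \<Longrightarrow> Y t \<omega> \<in> vecs p"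
  using measurable_space[OF Y_measurable] by (simp add: space_PiM)

text \<open>The factor \<open>1 / \<kappa>\<^sub>s'\<close> in the Lipschitz constant of
  \<open>H\<close> cancels the \<open>L(q)\<close> bound of the noise norm, which leaves exactly
  \<open>a\<^sub>2\<close>.\<close>

lemma lq_bounded_gain:
  assumes "1 \<le> q" "q \<le> 5"
  shows "lq_bounded M q (\<lambda>\<omega>. gain (E t \<omega>)) (a\<^sub>1 + a\<^sub>2)"
proof (rule lq_bounded_add[OF assms(1), where X = "\<lambda>_. a\<^sub>1" and Y = "\<lambda>\<omega>. a\<^sub>2 / \<kappa>\<^sub>s' * L2_set (E t \<omega>) {..<p}"])
  show "lq_bounded M q (\<lambda>_. a\<^sub>1) a\<^sub>1" using a1_nonneg by (simp add: lq_bounded_def emeasure_space_1)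
  have "lq_bounded M q (\<lambda>\<omega>. a\<^sub>2 / \<kappa>\<^sub>s' * L2_set (E t \<omega>) {..<p}) (\<bar>a\<^sub>2 / \<kappa>\<^sub>s'\<bar> * \<kappa>\<^sub>s')"
    using kappa_pos assms E_psi2_sign by (intro lq_bounded_mult lq_bounded_vec) auto
  thus "lq_bounded M q (\<lambda>\<omega>. a\<^sub>2 / \<kappa>\<^sub>s' * L2_set (E t \<omega>) {..<p}) a\<^sub>2"
    using kappa_pos contraction by simp
qed (use a1_nonneg contraction kappa_pos in \<open>auto simp: gain_def\<close>)

lemma Y_eq_step: "AE \<omega> in M. \<forall>t. Y t \<omega> = step (Y (t - 1) \<omega>) (E t \<omega>)"
proof -
  have "AE \<omega> in M. Y t \<omega> = step (Y (t - 1) \<omega>) (E t \<omega>)" for t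
    using recursion[of t] AE_space
  proof eventually_elim
    case (elim \<omega>)
    \<comment> \<open>Coordinates from \<open>p\<close> on agree because both sides are extensional;
      the recursion speaks only of those below \<open>p\<close>.\<close>
    have "Y t \<omega> i = step (Y (t - 1) \<omega>) (E t \<omega>) i" for i
      using elim Y_in_vecs[of \<omega> t] by (cases "i < p") (auto simp: step_def PiE_def extensional_def)
    thus ?case by blast
  qed
  thus ?thesis by (simp add: AE_all_countable)
qed

lemma Y_eq_traj: "AE \<omega> in M. \<forall>j n. Y (j + int n) \<omega> = traj j (Y j \<omega>) (\<lambda>s. E s \<omega>) n"
  using Y_eq_step
proof eventually_elim
  case (elim \<omega>)
  have "Y (j + int n) \<omega> = traj j (Y j \<omega>) (\<lambda>s. E s \<omega>) n" for j n
  proof (induction n)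
    case (Suc n)
    have "Y (j + int (Suc n)) \<omega> = step (Y (j + int (Suc n) - 1) \<omega>) (E (j + int (Suc n)) \<omega>)"
      using elim by blast
    thus ?case using Suc by (simp add: add.commute add.left_commute)
  qed simp
  thus ?case by blast
qed

end

section \<open>Causality and the stationary case\<close>

context nonlinear_ar
begin

lemma rho_pos: "0 < a\<^sub>1 + a\<^sub>2"
  using a1_nonneg contraction by simp

lemma gain_measurable [measurable]: "gain \<in> borel_measurable (vec_borel p)"
  unfolding gain_def by measurable

text \<open>The gains are functions of distinct independent noise vectors, so the expectation of the
  product factorises.\<close>

lemma nn_integral_gain_prod:
  "(\<integral>\<^sup>+\<omega>. ennreal ((\<Prod>s\<in>{j<..j + int n}. gain (E s \<omega>))\<^sup>2) \<partial>M) \<le> ennreal (((a\<^sub>1 + a\<^sub>2) ^ n)\<^sup>2)"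
proof -
  let ?I = "{j<..j + int n}"
  have ind: "indep_vars (\<lambda>_. borel) (\<lambda>s \<omega>. ennreal ((gain (E s \<omega>))\<^sup>2)) ?I"
    by (rule indep_vars_compose2[OF indep_vars_subset[OF E_indep]]) auto
  have "(\<integral>\<^sup>+\<omega>. ennreal ((\<Prod>s\<in>?I. gain (E s \<omega>))\<^sup>2) \<partial>M) = (\<integral>\<^sup>+\<omega>. (\<Prod>s\<in>?I. ennreal ((gain (E s \<omega>))\<^sup>2)) \<partial>M)"
    by (simp add: prod_ennreal prod_power_distrib)
  also have "\<dots> = (\<Prod>s\<in>?I. \<integral>\<^sup>+\<omega>. ennreal ((gain (E s \<omega>))\<^sup>2) \<partial>M)"
    by (rule indep_vars_nn_integral[OF _ ind]) auto
  also have "\<dots> \<le> (\<Prod>s\<in>?I. ennreal ((a\<^sub>1 + a\<^sub>2)\<^sup>2))"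
    using rho_pos by (intro prod_mono_ennreal) (auto intro!: nn_integral_lq_bounded_square lq_bounded_gain)
  also have "\<dots> = ennreal (((a\<^sub>1 + a\<^sub>2) ^ n)\<^sup>2)"
    by (simp add: ennreal_power flip: power_mult) (simp add: mult.commute)
  finally show ?thesis .
qed

text \<open>Since \<open>lim\<close> is total, this is a measurable function of all noise paths. Its
  value is arbitrary where the sequence diverges; \<open>Y_causal\<close> shows that, under a second
  moment bound on \<open>Y\<close>, this happens with probability 0.\<close>

definition limit_map :: "int \<Rightarrow> (int \<Rightarrow> nat \<Rightarrow> real) \<Rightarrow> nat \<Rightarrow> real" where
  "limit_map t e = (\<lambda>i\<in>{..<p}. lim (\<lambda>n. traj (t - int n) (\<lambda>i\<in>{..<p}. 0) e n i))"

lemma limit_map_measurable: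
  assumes "\<And>s. s \<le> t \<Longrightarrow> (\<lambda>x. g x s) \<in> N \<rightarrow>\<^sub>M vec_borel p"
  shows "(\<lambda>x. limit_map t (g x)) \<in> N \<rightarrow>\<^sub>M vec_borel p"
  unfolding limit_map_def
proof (intro measurable_vecI borel_measurable_lim_metric measurable_vec_component)
  fix n show "(\<lambda>x. traj (t - int n) (\<lambda>i\<in>{..<p}. 0) (g x) n) \<in> N \<rightarrow>\<^sub>M vec_borel p"
    by (rule traj_measurable[OF zero_measurable]) (use assms in auto)
qed

lemma limit_map_cong:
  assumes "\<And>s. s \<le> t \<Longrightarrow> e s = e' s"
  shows "limit_map t e = limit_map t e'"
proof -
  have "traj (t - int n) y e n = traj (t - int n) y e' n" for n y
    by (rule traj_cong) (use assms in auto)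
  thus ?thesis by (simp add: limit_map_def)
qed

text \<open>Started from zero at time \<open>t - n\<close>, the recursion misses \<open>Y t\<close> by at most the product \<open>P\<close> of \<open>n\<close>
  independent gains times the norm of \<open>Y (t - n)\<close>. These two factors may be dependent, but
  \<open>2 * P * x \<le> P\<^sup>2 / \<rho> ^ n + \<rho> ^ n * x\<^sup>2\<close> with \<open>\<rho> = a\<^sub>1 + a\<^sub>2\<close> still has summable expectation.\<close>

lemma Y_causal:
  assumes K: "\<And>t. lq_bounded M 2 (\<lambda>\<omega>. L2_set (Y t \<omega>) {..<p}) K" "0 \<le> K"
  shows "AE \<omega> in M. \<forall>t. Y t \<omega> = limit_map t (\<lambda>s. E s \<omega>)"
proof -
  have "AE \<omega> in M. Y t \<omega> = limit_map t (\<lambda>s. E s \<omega>)" for t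
  proof -
    define \<rho> where "\<rho> = a\<^sub>1 + a\<^sub>2"
    have \<rho>: "0 < \<rho>" "\<rho> < 1" using rho_pos contraction by (auto simp: \<rho>_def)
    define P where "P n \<omega> = (\<Prod>s\<in>{t - int n<..t}. gain (E s \<omega>))" for n \<omega>
    define W where "W n \<omega> = P n \<omega> * L2_set (Y (t - int n) \<omega>) {..<p}" for n \<omega>
    have [measurable]: "P n \<in> borel_measurable M" for n unfolding P_def by measurable
    have Wm: "W n \<in> borel_measurable M" for n unfolding W_def by measurable
    have P0: "0 \<le> P n \<omega>" for n \<omega> unfolding P_def by (intro prod_nonneg) (simp add: gain_nonneg)
    have W0: "0 \<le> W n \<omega>" for n \<omega> using P0 by (simp add: W_def)
    have W_int: "(\<integral>\<^sup>+\<omega>. ennreal (W n \<omega>) \<partial>M) \<le> ennreal ((1 + K\<^sup>2) / 2 * \<rho> ^ n)" for n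
    proof -
      let ?r = "\<rho> ^ n"
      have "0 < ?r" using \<rho> by simp
      have pw: "W n \<omega> \<le> 1 / (2 * ?r) * (P n \<omega>)\<^sup>2 + ?r / 2 * (L2_set (Y (t - int n) \<omega>) {..<p})\<^sup>2" for \<omega>
        using product_le_weighted_squares[OF \<open>0 < ?r\<close>] by (simp add: W_def)
      have "(\<integral>\<^sup>+\<omega>. ennreal (W n \<omega>) \<partial>M) \<le> (\<integral>\<^sup>+\<omega>. ennreal (1 / (2 * ?r)) * ennreal ((P n \<omega>)\<^sup>2)
          + ennreal (?r / 2) * ennreal ((L2_set (Y (t - int n) \<omega>) {..<p})\<^sup>2) \<partial>M)"
        using \<open>0 < ?r\<close> pw by (intro nn_integral_mono) (simp add: ennreal_leI flip: ennreal_mult ennreal_plus)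
      also have "\<dots> = ennreal (1 / (2 * ?r)) * (\<integral>\<^sup>+\<omega>. ennreal ((P n \<omega>)\<^sup>2) \<partial>M)
          + ennreal (?r / 2) * (\<integral>\<^sup>+\<omega>. ennreal ((L2_set (Y (t - int n) \<omega>) {..<p})\<^sup>2) \<partial>M)"
        by (simp add: nn_integral_add nn_integral_cmult)
      also have "\<dots> \<le> ennreal (1 / (2 * ?r)) * ennreal (?r\<^sup>2) + ennreal (?r / 2) * ennreal (K\<^sup>2)"
      proof (intro add_mono mult_left_mono)
        show "(\<integral>\<^sup>+\<omega>. ennreal ((P n \<omega>)\<^sup>2) \<partial>M) \<le> ennreal (?r\<^sup>2)"
          using nn_integral_gain_prod[of "t - int n" n] by (simp add: P_def \<rho>_def)
      qed (auto intro!: nn_integral_lq_bounded_square K)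
      also have "\<dots> = ennreal ((1 + K\<^sup>2) / 2 * ?r)"
      proof -
        have "ennreal (1 / (2 * r)) * ennreal (r\<^sup>2) + ennreal (r / 2) * ennreal (K\<^sup>2)
            = ennreal (1 / (2 * r) * r\<^sup>2 + r / 2 * K\<^sup>2)" if "0 < r" for r
          using that by (simp flip: ennreal_mult ennreal_plus)
        moreover have "1 / (2 * r) * r\<^sup>2 + r / 2 * K\<^sup>2 = (1 + K\<^sup>2) / 2 * r" if "0 < r" for r
          using that by (simp add: field_simps power2_eq_square)
        ultimately show ?thesis using \<open>0 < ?r\<close> by presburger
      qed
      finally show ?thesis .
    qed
    have "(\<integral>\<^sup>+\<omega>. (\<Sum>n. ennreal (W n \<omega>)) \<partial>M) = (\<Sum>n. \<integral>\<^sup>+\<omega>. ennreal (W n \<omega>) \<partial>M)"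
      using Wm by (intro nn_integral_suminf) auto
    also have "\<dots> \<le> (\<Sum>n. ennreal ((1 + K\<^sup>2) / 2 * \<rho> ^ n))"
      by (intro suminf_le W_int) auto
    also have "\<dots> < \<infinity>"
    proof -
      have "summable (\<lambda>n. (1 + K\<^sup>2) / 2 * \<rho> ^ n)"
        using \<rho> by (intro summable_mult summable_geometric) auto
      moreover have "0 \<le> (1 + K\<^sup>2) / 2 * \<rho> ^ n" for n using \<rho> by simp
      ultimately have "(\<Sum>n. ennreal ((1 + K\<^sup>2) / 2 * \<rho> ^ n)) \<noteq> top"
        by (rule ennreal_suminf_neq_top)
      thus ?thesis by (simp only: infinity_ennreal_def less_top)
    qed
    finally have "AE \<omega> in M. (\<Sum>n. ennreal (W n \<omega>)) \<noteq> \<infinity>"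
      using Wm by (intro nn_integral_noteq_infinite) auto
    thus ?thesis using Y_eq_traj AE_space
    proof eventually_elim
      case (elim \<omega>)
      \<comment> \<open>A finite expected sum makes the series converge almost surely, so its terms
        tend to 0. This turns decay in mean into pointwise convergence.\<close>
      have "summable (\<lambda>n. W n \<omega>)" using elim W0 by (intro summable_suminf_not_top) auto
      hence W_lim: "(\<lambda>n. W n \<omega>) \<longlonglongrightarrow> 0" by (rule summable_LIMSEQ_zero)
      have lim: "(\<lambda>n. traj (t - int n) (\<lambda>i\<in>{..<p}. 0) (\<lambda>s. E s \<omega>) n i) \<longlonglongrightarrow> Y t \<omega> i" if "i < p" for i
      proof -
        have "\<bar>traj (t - int n) (\<lambda>i\<in>{..<p}. 0) (\<lambda>s. E s \<omega>) n i - Y t \<omega> i\<bar> \<le> W n \<omega>" for n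
        proof -
          let ?d = "\<lambda>i. traj (t - int n) (Y (t - int n) \<omega>) (\<lambda>s. E s \<omega>) n i - traj (t - int n) (\<lambda>i\<in>{..<p}. 0) (\<lambda>s. E s \<omega>) n i"
          have "Y (t - int n + int n) \<omega> = traj (t - int n) (Y (t - int n) \<omega>) (\<lambda>s. E s \<omega>) n" using elim by blast
          hence "\<bar>traj (t - int n) (\<lambda>i\<in>{..<p}. 0) (\<lambda>s. E s \<omega>) n i - Y t \<omega> i\<bar> = \<bar>?d i\<bar>" by simp
          also have "\<dots> \<le> L2_set (\<lambda>i. \<bar>?d i\<bar>) {..<p}" using that by (intro member_le_L2_set) auto
          also have "\<dots> = L2_set ?d {..<p}" by (simp add: L2_set_def)
          also have "\<dots> \<le> (\<Prod>s\<in>{t - int n<..t - int n + int n}. gain (E s \<omega>)) * L2_set (\<lambda>i. Y (t - int n) \<omega> i - (\<lambda>i\<in>{..<p}. 0) i) {..<p}"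
            using elim Y_in_vecs by (intro traj_contraction) auto
          also have "L2_set (\<lambda>i. Y (t - int n) \<omega> i - (\<lambda>i\<in>{..<p}. 0) i) {..<p} = L2_set (Y (t - int n) \<omega>) {..<p}"
            by (rule L2_set_cong) auto
          finally show ?thesis by (simp only: W_def P_def diff_add_cancel)
        qed
        hence "(\<lambda>n. traj (t - int n) (\<lambda>i\<in>{..<p}. 0) (\<lambda>s. E s \<omega>) n i - Y t \<omega> i) \<longlonglongrightarrow> 0"
          by (intro Lim_null_comparison[OF _ W_lim]) auto
        thus ?thesis by (rule LIM_zero_cancel)
      qed
      show ?case
      proof
        fix i
        show "Y t \<omega> i = limit_map t (\<lambda>s. E s \<omega>) i"
          using lim[THEN limI, of i] Y_in_vecs[of \<omega> t] elim
          by (cases "i < p") (auto simp: limit_map_def PiE_def extensional_def)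
      qed
    qed
  qed
  thus ?thesis by (simp add: AE_all_countable)
qed

lemma E_past_future_indep:
  "indep_var (PiM {..j} (\<lambda>_. vec_borel p)) (\<lambda>\<omega>. \<lambda>t\<in>{..j}. E t \<omega>)
    (PiM {j<..} (\<lambda>_. vec_borel p)) (\<lambda>\<omega>. \<lambda>t\<in>{j<..}. E t \<omega>)"
  by (rule indep_var_restrict[OF E_indep]) auto

text \<open>By \<open>limit_map_cong\<close>, the values \<open>limit_map t\<close> with
  \<open>t \<le> j\<close> do not change when the noise path is restricted to \<open>{..j}\<close>.
  So independence of past and future noise passes to a version of the past of \<open>Y\<close>, and
  from there to \<open>Y\<close> itself.\<close>

lemma Y_past_indep:
  assumes "AE \<omega> in M. \<forall>t. Y t \<omega> = limit_map t (\<lambda>s. E s \<omega>)"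
  shows "indep_var (PiM {..j} (\<lambda>_. vec_borel p)) (\<lambda>\<omega>. \<lambda>t\<in>{..j}. Y t \<omega>)
    (PiM {j<..} (\<lambda>_. vec_borel p)) (\<lambda>\<omega>. \<lambda>t\<in>{j<..}. E t \<omega>)"
proof (rule indep_var_AE_cong)
  show "indep_var (PiM {..j} (\<lambda>_. vec_borel p)) ((\<lambda>e. \<lambda>t\<in>{..j}. limit_map t e) \<circ> (\<lambda>\<omega>. \<lambda>t\<in>{..j}. E t \<omega>))
    (PiM {j<..} (\<lambda>_. vec_borel p)) ((\<lambda>e. e) \<circ> (\<lambda>\<omega>. \<lambda>t\<in>{j<..}. E t \<omega>))"
    by (rule indep_var_compose[OF E_past_future_indep])
      (auto intro!: measurable_restrict limit_map_measurable restrict_measurable_component)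
  show "AE \<omega> in M. ((\<lambda>e. \<lambda>t\<in>{..j}. limit_map t e) \<circ> (\<lambda>\<omega>. \<lambda>t\<in>{..j}. E t \<omega>)) \<omega> = (\<lambda>t\<in>{..j}. Y t \<omega>)"
    using assms
  proof eventually_elim
    case (elim \<omega>)
    show ?case using elim
      by (auto simp: fun_eq_iff[of _ "restrict _ _"] intro!: limit_map_cong[THEN fun_cong])
  qed
qed (auto intro!: measurable_restrict)

text \<open>The start \<open>y\<close> of the second trajectory is a fixed vector here and is
  integrated out later over the second factor. Both states are then almost surely functions of the
  noise up to time \<open>j + n\<close>, so the next noise vector can be integrated
  separately.\<close>

lemma pair_nn_integral:
  assumes causal: "AE \<omega> in M. \<forall>t. Y t \<omega> = limit_map t (\<lambda>s. E s \<omega>)" and y: "y \<in> vecs p"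
    and f: "f \<in> borel_measurable ((vec_borel p \<Otimes>\<^sub>M vec_borel p) \<Otimes>\<^sub>M vec_borel p)"
  shows "(\<integral>\<^sup>+\<omega>. f ((Y (j + int n) \<omega>, traj j y (\<lambda>s. E s \<omega>) n), E (j + int n + 1) \<omega>) \<partial>M)
    = (\<integral>\<^sup>+\<omega>. \<integral>\<^sup>+\<omega>'. f ((Y (j + int n) \<omega>, traj j y (\<lambda>s. E s \<omega>) n), E (j + int n + 1) \<omega>') \<partial>M \<partial>M)"
proof -
  let ?k = "j + int n"
  let ?Z = "\<lambda>\<omega>. (limit_map ?k (\<lambda>s. E s \<omega>), traj j y (\<lambda>s. E s \<omega>) n)"
  let ?g = "\<lambda>(e, e'). f ((limit_map ?k e, traj j y e n), e' (?k + 1))"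
  have g: "?g \<in> borel_measurable (PiM {..?k} (\<lambda>_. vec_borel p) \<Otimes>\<^sub>M PiM {?k<..} (\<lambda>_. vec_borel p))"
    unfolding case_prod_beta using y
    by (intro measurable_compose[OF _ f] measurable_Pair limit_map_measurable traj_measurable
        measurable_compose[OF measurable_fst restrict_measurable_component]
        measurable_compose[OF measurable_snd restrict_measurable_component]) (auto simp: space_PiM)
  have Z: "limit_map ?k (\<lambda>t\<in>{..?k}. E t \<omega>) = limit_map ?k (\<lambda>t. E t \<omega>)"
    "traj j y (\<lambda>t\<in>{..?k}. E t \<omega>) n = traj j y (\<lambda>t. E t \<omega>) n" for \<omega>
    by (auto intro!: limit_map_cong traj_cong)
  have "(\<integral>\<^sup>+\<omega>. f ((Y ?k \<omega>, traj j y (\<lambda>s. E s \<omega>) n), E (?k + 1) \<omega>) \<partial>M) = (\<integral>\<^sup>+\<omega>. f (?Z \<omega>, E (?k + 1) \<omega>) \<partial>M)"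
    using causal by (intro nn_integral_cong_AE) (auto elim!: eventually_mono)
  also have "\<dots> = (\<integral>\<^sup>+\<omega>. \<integral>\<^sup>+\<omega>'. f (?Z \<omega>, E (?k + 1) \<omega>') \<partial>M \<partial>M)"
    using indep_var_nn_integral[OF E_past_future_indep g] by (simp add: Z)
  also have "\<dots> = (\<integral>\<^sup>+\<omega>. \<integral>\<^sup>+\<omega>'. f ((Y ?k \<omega>, traj j y (\<lambda>s. E s \<omega>) n), E (?k + 1) \<omega>') \<partial>M \<partial>M)"
    using causal by (intro nn_integral_cong_AE) (auto elim!: eventually_mono)
  finally show ?thesis .
qed

text \<open>Serves the degenerate case in which the claimed bounds are 0. The projections include
  the coordinates, so every coordinate of \<open>Y t\<close> vanishes almost surely.\<close>

lemma sign_sup_psi2_eq_0: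
  assumes "sup_psi2 M p (unit_sphere p) Y = 0"
  shows "sup_psi2 M p (sign_vectors p) Y = 0"
proof -
  have ae: "AE \<omega> in M. \<forall>i<p. Y t \<omega> i = 0" for t
  proof -
    have "AE \<omega> in M. Y t \<omega> i = 0" if i: "i < p" for i
    proof -
      define w :: "nat \<Rightarrow> real" where "w = (\<lambda>k. if k = i then 1 else 0)"
      have w: "inner_vec p w y = y i" for y
      proof -
        have "inner_vec p w y = (\<Sum>k<p. if k = i then y k else 0)"
          unfolding inner_vec_def w_def by (intro sum.cong) auto
        thus ?thesis using i by simp
      qed
      have "lq_bounded M 1 (\<lambda>\<omega>. inner_vec p w (Y t \<omega>)) (L2_set w {..<p} * 0)"
        using assms by (intro lq_bounded_projection) auto
      hence "(\<integral>\<^sup>+\<omega>. ennreal \<bar>Y t \<omega> i\<bar> \<partial>M) = 0" by (simp add: lq_bounded_def w)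
      thus ?thesis using i by (subst (asm) nn_integral_0_iff_AE) auto
    qed
    hence "AE \<omega> in M. \<forall>i\<in>{..<p}. Y t \<omega> i = 0" by (intro eventually_ball_finite) auto
    thus ?thesis by (auto elim: eventually_mono)
  qed
  have "psi2_norm M (\<lambda>\<omega>. inner_vec p v (Y t \<omega>)) \<le> 0" for t v
  proof (rule ennreal_le_epsilon)
    fix e :: real assume e: "0 < e"
    have "(\<integral>\<^sup>+\<omega>. ennreal (exp ((\<bar>inner_vec p v (Y t \<omega>)\<bar> / e)\<^sup>2) - 1) \<partial>M) = (\<integral>\<^sup>+\<omega>. 0 \<partial>M)"
      using ae[of t] by (intro nn_integral_cong_AE) (auto elim!: eventually_mono simp: inner_vec_def)
    thus "psi2_norm M (\<lambda>\<omega>. inner_vec p v (Y t \<omega>)) \<le> 0 + ennreal e"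
      using psi2_norm_leI[OF e, where X = "\<lambda>\<omega>. inner_vec p v (Y t \<omega>)" and M = M] by simp
  qed
  hence "sup_psi2 M p (sign_vectors p) Y \<le> 0" unfolding sup_psi2_def by (intro SUP_least) auto
  thus ?thesis by simp
qed

text \<open>The first \<open>n\<close> terms of the geometric noise series, in Horner form: each
  step combines one new noise norm with the same object at time \<open>t - 1\<close>, the shape
  needed for a convexity induction.\<close>

primrec noise_sum :: "real \<Rightarrow> nat \<Rightarrow> int \<Rightarrow> 'a \<Rightarrow> real" where
  "noise_sum D 0 t \<omega> = 0"
| "noise_sum D (Suc n) t \<omega> = D * L2_set (E t \<omega>) {..<p} + a\<^sub>1 * noise_sum D n (t - 1) \<omega>"

lemma noise_sum_measurable [measurable]: "noise_sum D n t \<in> borel_measurable M"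
proof (induction n arbitrary: t)
  case (Suc n)
  have "noise_sum D (Suc n) t = (\<lambda>\<omega>. D * L2_set (E t \<omega>) {..<p} + a\<^sub>1 * noise_sum D n (t - 1) \<omega>)" by auto
  thus ?case using Suc by simp
qed (simp add: noise_sum.simps(1)[abs_def])

lemma noise_sum_nonneg: "0 \<le> D \<Longrightarrow> 0 \<le> noise_sum D n t \<omega>"
  by (induction n arbitrary: t) (auto simp: a1_nonneg)

lemma noise_sum_Suc_ge: "0 \<le> D \<Longrightarrow> noise_sum D n t \<omega> \<le> noise_sum D (Suc n) t \<omega>"
proof (induction n arbitrary: t)
  case (Suc n)
  have "a\<^sub>1 * noise_sum D n (t - 1) \<omega> \<le> a\<^sub>1 * noise_sum D (Suc n) (t - 1) \<omega>"
    by (rule mult_left_mono[OF Suc.IH[OF Suc.prems] a1_nonneg])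
  thus ?case by simp
qed simp

lemma Y_le_noise_sum:
  assumes D: "\<And>u. u \<in> vecs p \<Longrightarrow> spectral_norm p (H u) \<le> D"
  shows "AE \<omega> in M. \<forall>t n. L2_set (Y t \<omega>) {..<p} \<le> a\<^sub>1 ^ n * L2_set (Y (t - int n) \<omega>) {..<p} + noise_sum D n t \<omega>"
  using Y_eq_step AE_space
proof eventually_elim
  case (elim \<omega>)
  have step: "L2_set (Y t \<omega>) {..<p} \<le> a\<^sub>1 * L2_set (Y (t - 1) \<omega>) {..<p} + D * L2_set (E t \<omega>) {..<p}" for t
  proof -
    let ?y = "Y (t - 1) \<omega>"
    have "L2_set (Y t \<omega>) {..<p} = L2_set (\<lambda>i. mat_vec p A ?y i + mat_vec p (H ?y) (E t \<omega>) i) {..<p}"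
      using elim(1)[rule_format, of t] by (simp add: step_def)
    also have "\<dots> \<le> L2_set (mat_vec p A ?y) {..<p} + L2_set (mat_vec p (H ?y) (E t \<omega>)) {..<p}"
      by (rule L2_set_triangle_ineq)
    also have "\<dots> \<le> spectral_norm p A * L2_set ?y {..<p} + spectral_norm p (H ?y) * L2_set (E t \<omega>) {..<p}"
      by (intro add_mono L2_set_mat_vec_le)
    also have "\<dots> \<le> a\<^sub>1 * L2_set ?y {..<p} + D * L2_set (E t \<omega>) {..<p}"
      using A_norm D Y_in_vecs[OF elim(2)] by (intro add_mono mult_right_mono) auto
    finally show ?thesis .
  qed
  have "L2_set (Y t \<omega>) {..<p} \<le> a\<^sub>1 ^ n * L2_set (Y (t - int n) \<omega>) {..<p} + noise_sum D n t \<omega>" for t n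
  proof (induction n arbitrary: t)
    case (Suc n)
    have "L2_set (Y t \<omega>) {..<p} \<le> a\<^sub>1 * L2_set (Y (t - 1) \<omega>) {..<p} + D * L2_set (E t \<omega>) {..<p}" by (rule step)
    also have "\<dots> \<le> a\<^sub>1 * (a\<^sub>1 ^ n * L2_set (Y (t - 1 - int n) \<omega>) {..<p} + noise_sum D n (t - 1) \<omega>) + D * L2_set (E t \<omega>) {..<p}"
      using a1_nonneg by (intro add_right_mono mult_left_mono Suc)
    also have "t - 1 - int n = t - int (Suc n)" by simp
    finally show ?case by (simp add: algebra_simps)
  qed simp
  thus ?case by blast
qed

text \<open>\<open>K\<close> is chosen so that after division the recursion of
  \<open>noise_sum\<close> becomes a convex combination with weights \<open>1 - a\<^sub>1\<close>
  and \<open>a\<^sub>1\<close>; convexity of \<open>exp (x\<^sup>2) - 1\<close> then reproduces the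
  bound 1. The 2 in \<open>K\<close> leaves room for the strict inequality in
  \<open>psi2_norm_lessD\<close>.\<close>

lemma nn_integral_exp_noise_sum:
  assumes D: "0 < D" and K: "K = D * (2 * \<kappa>\<^sub>s') / (1 - a\<^sub>1)"
  shows "(\<integral>\<^sup>+\<omega>. ennreal (exp ((noise_sum D n t \<omega> / K)\<^sup>2) - 1) \<partial>M) \<le> 1"
proof (induction n arbitrary: t)
  case (Suc n)
  have E: "(\<integral>\<^sup>+\<omega>. ennreal (exp ((L2_set (E t \<omega>) {..<p} / (2 * \<kappa>\<^sub>s'))\<^sup>2) - 1) \<partial>M) \<le> 1"
  proof -
    have "psi2_norm M (\<lambda>\<omega>. L2_set (E t \<omega>) {..<p}) \<le> ennreal \<kappa>\<^sub>s'"
      using kappa_pos by (intro psi2_norm_L2_set_le order_trans[OF psi2_norm_le_sup_psi2 E_psi2_sign]) auto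
    also have "\<dots> < ennreal (2 * \<kappa>\<^sub>s')" using kappa_pos by (simp add: ennreal_less_iff)
    finally show ?thesis using psi2_norm_lessD by fastforce
  qed
  have "D * x / K = (1 - a\<^sub>1) * (x / (2 * \<kappa>\<^sub>s'))" for x using D by (simp add: K)
  hence eq: "noise_sum D (Suc n) t \<omega> / K
      = (1 - a\<^sub>1) * (L2_set (E t \<omega>) {..<p} / (2 * \<kappa>\<^sub>s')) + a\<^sub>1 * (noise_sum D n (t - 1) \<omega> / K)" for \<omega>
    by (simp add: add_divide_distrib)
  have "exp ((noise_sum D (Suc n) t \<omega> / K)\<^sup>2) - 1
      \<le> (1 - a\<^sub>1) * (exp ((L2_set (E t \<omega>) {..<p} / (2 * \<kappa>\<^sub>s'))\<^sup>2) - 1) + a\<^sub>1 * (exp ((noise_sum D n (t - 1) \<omega> / K)\<^sup>2) - 1)" for \<omega>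
    unfolding eq using a1_nonneg contraction by (intro exp_square_convex) auto
  hence "(\<integral>\<^sup>+\<omega>. ennreal (exp ((noise_sum D (Suc n) t \<omega> / K)\<^sup>2) - 1) \<partial>M)
    \<le> (\<integral>\<^sup>+\<omega>. ennreal (1 - a\<^sub>1) * ennreal (exp ((L2_set (E t \<omega>) {..<p} / (2 * \<kappa>\<^sub>s'))\<^sup>2) - 1)
         + ennreal a\<^sub>1 * ennreal (exp ((noise_sum D n (t - 1) \<omega> / K)\<^sup>2) - 1) \<partial>M)"
    using a1_nonneg contraction
    by (intro nn_integral_mono) (simp add: ennreal_leI flip: ennreal_mult ennreal_plus del: noise_sum.simps)
  also have "\<dots> = ennreal (1 - a\<^sub>1) * (\<integral>\<^sup>+\<omega>. ennreal (exp ((L2_set (E t \<omega>) {..<p} / (2 * \<kappa>\<^sub>s'))\<^sup>2) - 1) \<partial>M)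
         + ennreal a\<^sub>1 * (\<integral>\<^sup>+\<omega>. ennreal (exp ((noise_sum D n (t - 1) \<omega> / K)\<^sup>2) - 1) \<partial>M)"
    by (simp add: nn_integral_add nn_integral_cmult)
  also have "\<dots> \<le> ennreal (1 - a\<^sub>1) * 1 + ennreal a\<^sub>1 * 1"
    by (intro add_mono mult_left_mono E Suc) auto
  also have "\<dots> = 1" using a1_nonneg contraction by (simp flip: ennreal_plus)
  finally show ?case .
qed simp

lemma stationary_marginal:
  assumes "stationary M p Y"
  shows "distr M (vec_borel p) (Y t) = distr M (vec_borel p) (Y s)"
proof -
  let ?P = "PiM UNIV (\<lambda>_::int. vec_borel p)"
  have "distr M (vec_borel p) (Y (s + h)) = distr (distr M ?P (\<lambda>\<omega> t. Y (t + h) \<omega>)) (vec_borel p) (\<lambda>e. e s)" for h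
  proof -
    have "(\<lambda>\<omega>. \<lambda>t\<in>UNIV. Y (t + h) \<omega>) \<in> M \<rightarrow>\<^sub>M ?P" by (intro measurable_restrict Y_measurable)
    hence "(\<lambda>\<omega> t. Y (t + h) \<omega>) \<in> M \<rightarrow>\<^sub>M ?P" by (simp only: restrict_UNIV)
    thus ?thesis by (subst distr_distr) (auto simp: comp_def)
  qed
  hence "distr M (vec_borel p) (Y (s + h)) = distr M (vec_borel p) (Y (s + 0))" for h
    using assms unfolding stationary_def by (metis (no_types, lifting))
  from this[of "t - s"] show ?thesis by simp
qed

text \<open>The remainder \<open>a\<^sub>1 ^ n * L2_set (Y (t - int n) \<omega>) {..<p}\<close> is
  not controlled pathwise. By stationarity it has the law of the same expression with
  \<open>Y t\<close>, which tends to 0 pointwise and hence in probability. An excess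
  \<open>\<delta>\<close> over all noise sums forces the remainder above \<open>\<delta>\<close> for
  every \<open>n\<close>, so it has probability 0.\<close>

lemma stationary_le_noise_sum:
  assumes stat: "stationary M p Y" and D: "\<And>u. u \<in> vecs p \<Longrightarrow> spectral_norm p (H u) \<le> D" and "0 < \<delta>"
  shows "AE \<omega> in M. \<exists>n. L2_set (Y t \<omega>) {..<p} \<le> noise_sum D n t \<omega> + \<delta>"
proof -
  define B where "B n = {\<omega>\<in>space M. \<delta> < a\<^sub>1 ^ n * L2_set (Y t \<omega>) {..<p}}" for n
  define U where "U = {\<omega>\<in>space M. \<forall>n. noise_sum D n t \<omega> + \<delta> < L2_set (Y t \<omega>) {..<p}}"
  have sets: "U \<in> sets M" "\<And>n. B n \<in> sets M" unfolding U_def B_def by measurable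
  have "decseq B"
  proof (rule decseq_SucI, rule subsetI)
    fix n \<omega> assume "\<omega> \<in> B (Suc n)"
    moreover have "a\<^sub>1 * (a\<^sub>1 ^ n * L2_set (Y t \<omega>) {..<p}) \<le> 1 * (a\<^sub>1 ^ n * L2_set (Y t \<omega>) {..<p})"
      using a1_nonneg contraction by (intro mult_right_mono) auto
    ultimately show "\<omega> \<in> B n" by (simp add: B_def mult.assoc)
  qed
  moreover have "(\<Inter>n. B n) = {}"
  proof -
    have "\<exists>n. \<not> \<delta> < a\<^sub>1 ^ n * L2_set (Y t \<omega>) {..<p}" for \<omega>
    proof -
      have "(\<lambda>n. a\<^sub>1 ^ n * L2_set (Y t \<omega>) {..<p}) \<longlonglongrightarrow> 0 * L2_set (Y t \<omega>) {..<p}"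
        using a1_nonneg contraction by (intro tendsto_mult tendsto_const LIMSEQ_power_zero) auto
      hence "\<forall>\<^sub>F n in sequentially. a\<^sub>1 ^ n * L2_set (Y t \<omega>) {..<p} < \<delta>"
        using \<open>0 < \<delta>\<close> by (intro order_tendstoD(2)) auto
      then obtain n where "a\<^sub>1 ^ n * L2_set (Y t \<omega>) {..<p} < \<delta>"
        unfolding eventually_sequentially by blast
      thus ?thesis by (intro exI[of _ n]) simp
    qed
    thus ?thesis by (auto simp: B_def)
  qed
  ultimately have B_lim: "(\<lambda>n. measure M (B n)) \<longlonglongrightarrow> 0"
    using finite_Lim_measure_decseq[of B] sets by (auto simp: image_subset_iff)
  have bound: "AE \<omega> in M. \<forall>t n. L2_set (Y t \<omega>) {..<p} \<le> a\<^sub>1 ^ n * L2_set (Y (t - int n) \<omega>) {..<p} + noise_sum D n t \<omega>"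
    by (rule Y_le_noise_sum[OF D])
  have "measure M U \<le> measure M (B n)" for n
  proof -
    let ?S = "{x\<in>space (vec_borel p). \<delta> < a\<^sub>1 ^ n * L2_set x {..<p}}"
    have S: "?S \<in> sets (vec_borel p)" by measurable
    have marg: "measure (distr M (vec_borel p) (Y s)) ?S = measure M {\<omega>\<in>space M. \<delta> < a\<^sub>1 ^ n * L2_set (Y s \<omega>) {..<p}}" for s
    proof -
      have "Y s -` ?S \<inter> space M = {\<omega>\<in>space M. \<delta> < a\<^sub>1 ^ n * L2_set (Y s \<omega>) {..<p}}"
        using measurable_space[OF Y_measurable, of _ s] by blast
      thus ?thesis using measure_distr[OF Y_measurable S] by simp
    qed
    have "measure M U \<le> measure M {\<omega>\<in>space M. \<delta> < a\<^sub>1 ^ n * L2_set (Y (t - int n) \<omega>) {..<p}}"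
    proof (rule finite_measure_mono_AE)
      show "AE \<omega> in M. \<omega> \<in> U \<longrightarrow> \<omega> \<in> {\<omega>\<in>space M. \<delta> < a\<^sub>1 ^ n * L2_set (Y (t - int n) \<omega>) {..<p}}"
        using bound
      proof eventually_elim
        case (elim \<omega>)
        have "L2_set (Y t \<omega>) {..<p} \<le> a\<^sub>1 ^ n * L2_set (Y (t - int n) \<omega>) {..<p} + noise_sum D n t \<omega>"
          using elim by blast
        moreover have "\<omega> \<in> space M \<and> noise_sum D n t \<omega> + \<delta> < L2_set (Y t \<omega>) {..<p}" if "\<omega> \<in> U"
          using that unfolding U_def by blast
        ultimately show ?case by auto
      qed
    qed measurable
    also have "\<dots> = measure M (B n)"
      unfolding B_def marg[symmetric] stationary_marginal[OF stat, of "t - int n" t] ..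
    finally show ?thesis .
  qed
  hence "measure M U \<le> 0" by (intro LIMSEQ_le_const[OF B_lim]) auto
  hence "AE \<omega> in M. \<omega> \<notin> U" by (intro AE_not_in) (simp add: null_sets_def emeasure_eq_measure measure_le_0_iff sets)
  thus ?thesis using AE_space by eventually_elim (auto simp: U_def not_less)
qed

lemma stationary_exp_bound:
  assumes stat: "stationary M p Y" and H: "\<And>u. u \<in> vecs p \<Longrightarrow> spectral_norm p (H u) \<le> D"
    and D: "0 < D" and K: "K = D * (2 * \<kappa>\<^sub>s') / (1 - a\<^sub>1)"
  shows "(\<integral>\<^sup>+\<omega>. ennreal (exp ((L2_set (Y t \<omega>) {..<p} / K)\<^sup>2) - 1) \<partial>M) \<le> 1"
proof -
  let ?f = "\<lambda>x. ennreal (exp ((x / K)\<^sup>2) - 1)"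
  have K0: "0 < K" using D kappa_pos contraction unfolding K by simp
  have f_mono: "?f x \<le> ?f y" if "0 \<le> x" "x \<le> y" for x y
    using that K0 by (intro ennreal_leI diff_right_mono) (auto intro!: power_mono divide_right_mono)
  have "AE \<omega> in M. \<forall>m. \<exists>n. L2_set (Y t \<omega>) {..<p} \<le> noise_sum D n t \<omega> + 1 / real (Suc m)"
    using stationary_le_noise_sum[OF stat H] by (simp add: AE_all_countable)
  hence "AE \<omega> in M. ?f (L2_set (Y t \<omega>) {..<p}) \<le> (SUP n. ?f (noise_sum D n t \<omega>))"
  proof eventually_elim
    case (elim \<omega>)
    let ?y = "L2_set (Y t \<omega>) {..<p}"
    \<comment> \<open>Cutting at 0 keeps the argument where \<open>?f\<close> is increasing;
      continuity of \<open>?f\<close> then removes the slack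
      \<open>1 / real (Suc m)\<close>.\<close>
    let ?x = "\<lambda>m. max 0 (?y - 1 / real (Suc m))"
    have "?x \<longlonglongrightarrow> max 0 (?y - 0)"
      by (intro tendsto_max tendsto_diff tendsto_const LIMSEQ_Suc lim_1_over_n)
    hence "?x \<longlonglongrightarrow> ?y" by simp
    hence "(\<lambda>m. ?f (?x m)) \<longlonglongrightarrow> ?f ?y"
      using K0 by (intro tendsto_ennrealI tendsto_intros) auto
    moreover have "?f (?x m) \<le> (SUP n. ?f (noise_sum D n t \<omega>))" for m
    proof -
      obtain n where "?y \<le> noise_sum D n t \<omega> + 1 / real (Suc m)" using elim by blast
      hence "?x m \<le> noise_sum D n t \<omega>" using noise_sum_nonneg D by simp
      thus ?thesis by (intro SUP_upper2[of n] f_mono) auto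
    qed
    ultimately show ?case using LIMSEQ_le_const2 by blast
  qed
  hence "(\<integral>\<^sup>+\<omega>. ?f (L2_set (Y t \<omega>) {..<p}) \<partial>M) \<le> (\<integral>\<^sup>+\<omega>. (SUP n. ?f (noise_sum D n t \<omega>)) \<partial>M)"
    by (rule nn_integral_mono_AE)
  also have "\<dots> = (SUP n. \<integral>\<^sup>+\<omega>. ?f (noise_sum D n t \<omega>) \<partial>M)"
    using D noise_sum_nonneg noise_sum_Suc_ge
    by (intro nn_integral_monotone_convergence_SUP incseq_SucI le_funI f_mono) auto
  also have "\<dots> \<le> 1" using nn_integral_exp_noise_sum[OF D K] by (intro SUP_least) auto
  finally show ?thesis .
qed

lemma sup_psi2_finite:
  assumes exp: "\<And>t. (\<integral>\<^sup>+\<omega>. ennreal (exp ((L2_set (Y t \<omega>) {..<p} / K)\<^sup>2) - 1) \<partial>M) \<le> 1"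
    and K: "0 < K" and c: "0 < c" "\<And>v. v \<in> S \<Longrightarrow> L2_set v {..<p} \<le> c"
  shows "sup_psi2 M p S Y < \<infinity>"
proof -
  have "psi2_norm M (\<lambda>\<omega>. inner_vec p v (Y t \<omega>)) \<le> ennreal (c * K)" if "v \<in> S" for t v
  proof (rule psi2_norm_leI)
    have "\<bar>inner_vec p v y\<bar> / (c * K) \<le> L2_set y {..<p} / K" for y
    proof -
      have "\<bar>inner_vec p v y\<bar> \<le> c * L2_set y {..<p}"
        using abs_inner_vec_le[of p v y] mult_right_mono[OF c(2)[OF that], of "L2_set y {..<p}"] by simp
      thus ?thesis using K c by (simp add: field_simps)
    qed
    hence "(\<integral>\<^sup>+\<omega>. ennreal (exp ((\<bar>inner_vec p v (Y t \<omega>)\<bar> / (c * K))\<^sup>2) - 1) \<partial>M)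
      \<le> (\<integral>\<^sup>+\<omega>. ennreal (exp ((L2_set (Y t \<omega>) {..<p} / K)\<^sup>2) - 1) \<partial>M)"
      using K c by (intro nn_integral_mono ennreal_leI diff_right_mono) (auto intro!: power_mono)
    thus "(\<integral>\<^sup>+\<omega>. ennreal (exp ((\<bar>inner_vec p v (Y t \<omega>)\<bar> / (c * K))\<^sup>2) - 1) \<partial>M) \<le> 1"
      using exp order_trans by blast
  qed (use K c in simp)
  hence "sup_psi2 M p S Y \<le> ennreal (c * K)" unfolding sup_psi2_def by (intro SUP_least)
  thus ?thesis using ennreal_less_top le_less_trans by (metis infinity_ennreal_def)
qed

lemma stationary_sup_psi2_finite:
  assumes stat: "stationary M p Y" and D: "(SUP u\<in>vecs p. ennreal (spectral_norm p (H u))) < ennreal D"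
  shows "sup_psi2 M p (unit_sphere p) Y < \<infinity>" "sup_psi2 M p (sign_vectors p) Y < \<infinity>"
proof -
  have D0: "0 < D" using D by (metis ennreal_neg linorder_not_le not_less_zero)
  have H: "spectral_norm p (H u) \<le> D" if "u \<in> vecs p" for u
  proof -
    have "ennreal (spectral_norm p (H u)) \<le> (SUP u\<in>vecs p. ennreal (spectral_norm p (H u)))"
      using that by (rule SUP_upper)
    with D have "ennreal (spectral_norm p (H u)) \<le> ennreal D" by order
    thus ?thesis using D0 by (simp add: ennreal_le_iff)
  qed
  define K where "K = D * (2 * \<kappa>\<^sub>s') / (1 - a\<^sub>1)"
  have K: "0 < K" using D0 kappa_pos contraction by (simp add: K_def)
  note fin = sup_psi2_finite[OF stationary_exp_bound[OF stat H D0 K_def] K]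
  show "sup_psi2 M p (unit_sphere p) Y < \<infinity>"
    by (rule fin[of 1]) (auto simp: unit_sphere_def)
  show "sup_psi2 M p (sign_vectors p) Y < \<infinity>"
  \<comment> \<open>The Euclidean norm of a sign vector is \<open>sqrt p\<close>. The resulting
    bound grows with \<open>p\<close>, but only finiteness is claimed.\<close>
  proof (rule fin[of "sqrt p"])
    fix v assume "v \<in> sign_vectors p"
    hence "\<bar>v i\<bar>\<^sup>2 = 1" if "i < p" for i using that by (simp add: sign_vectors_def del: power2_abs)
    thus "L2_set v {..<p} \<le> sqrt p" by (simp add: L2_set_def)
  qed (use dim_pos in auto)
qed

end

section \<open>The coupling\<close>

lemma emeasure_distr_indicator:
  assumes "f \<in> M \<rightarrow>\<^sub>M N" "A \<in> sets N"
  shows "emeasure (distr M N f) A = (\<integral>\<^sup>+x. indicator A (f x) \<partial>M)"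
proof -
  have "emeasure (distr M N f) A = (\<integral>\<^sup>+y. indicator A y \<partial>distr M N f)" using assms(2) by simp
  also have "\<dots> = (\<integral>\<^sup>+x. indicator A (f x) \<partial>M)" using assms by (intro nn_integral_distr) auto
  finally show ?thesis .
qed

text \<open>Checked on rectangles. For a frozen second coordinate \<open>z\<close>, independence on
  \<open>M\<close> splits the integral into two factors; the one with \<open>X\<close> does not
  involve \<open>z\<close> and leaves the outer integral.\<close>

lemma indep_var_pair_extension:
  assumes M: "prob_space M" and L: "prob_space L"
    and ind: "prob_space.indep_var M S X T V" and Z: "Z \<in> L \<rightarrow>\<^sub>M U"
    and \<Psi>: "\<Psi> \<in> U \<Otimes>\<^sub>M T \<rightarrow>\<^sub>M R"
  shows "prob_space.indep_var (M \<Otimes>\<^sub>M L) S (X \<circ> fst) R (\<lambda>w. \<Psi> (Z (snd w), V (fst w)))"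
proof -
  interpret M: prob_space M by fact
  interpret L: prob_space L by fact
  interpret pair_prob_space M L ..
  note X = M.indep_var_rv1[OF ind] and V = M.indep_var_rv2[OF ind]
  note Z' = measurable_compose[OF measurable_snd Z] and V' = measurable_compose[OF measurable_fst V]
    and X' = measurable_compose[OF measurable_fst X]
  let ?W = "\<lambda>w. \<Psi> (Z (snd w), V (fst w))"
  have Xf: "X \<circ> fst \<in> M \<Otimes>\<^sub>M L \<rightarrow>\<^sub>M S" using X' by (simp add: comp_def)
  have W: "?W \<in> M \<Otimes>\<^sub>M L \<rightarrow>\<^sub>M R"
    by (intro measurable_compose[OF _ \<Psi>] measurable_Pair Z' V')
  have "distr (M \<Otimes>\<^sub>M L) S (X \<circ> fst) \<Otimes>\<^sub>M distr (M \<Otimes>\<^sub>M L) R ?W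
      = distr (M \<Otimes>\<^sub>M L) (S \<Otimes>\<^sub>M R) (\<lambda>w. ((X \<circ> fst) w, ?W w))"
  proof (rule pair_measure_eqI)
    fix A B assume "A \<in> sets (distr (M \<Otimes>\<^sub>M L) S (X \<circ> fst))" "B \<in> sets (distr (M \<Otimes>\<^sub>M L) R ?W)"
    hence A: "A \<in> sets S" and B: "B \<in> sets R" by auto
    let ?a = "\<lambda>x. indicator A x :: ennreal" and ?b = "\<lambda>x. indicator B x :: ennreal"
    have a: "?a \<in> borel_measurable S" and b: "?b \<in> borel_measurable R" using A B by auto
    have inner: "(\<integral>\<^sup>+\<omega>. ?a (X \<omega>) * ?b (\<Psi> (Z z, V \<omega>)) \<partial>M)
        = (\<integral>\<^sup>+\<omega>. ?a (X \<omega>) \<partial>M) * (\<integral>\<^sup>+\<omega>. ?b (\<Psi> (Z z, V \<omega>)) \<partial>M)" if z: "z \<in> space L" for z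
    proof -
      have c: "(\<lambda>v. \<Psi> (Z z, v)) \<in> T \<rightarrow>\<^sub>M R"
        using measurable_space[OF Z z] by (intro measurable_compose[OF _ \<Psi>] measurable_Pair) auto
      have f: "(\<lambda>(x, v). ?a x * ?b (\<Psi> (Z z, v))) \<in> borel_measurable (S \<Otimes>\<^sub>M T)"
        unfolding case_prod_beta
        by (intro borel_measurable_times_ennreal measurable_compose[OF measurable_fst a]
            measurable_compose[OF measurable_compose[OF measurable_snd c] b])
      have "(\<integral>\<^sup>+\<omega>. ?a (X \<omega>) * ?b (\<Psi> (Z z, V \<omega>)) \<partial>M)
          = (\<integral>\<^sup>+\<omega>. \<integral>\<^sup>+\<omega>'. ?a (X \<omega>) * ?b (\<Psi> (Z z, V \<omega>')) \<partial>M \<partial>M)"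
        using M.indep_var_nn_integral[OF ind f] by simp
      also have "\<dots> = (\<integral>\<^sup>+\<omega>. ?a (X \<omega>) * (\<integral>\<^sup>+\<omega>'. ?b (\<Psi> (Z z, V \<omega>')) \<partial>M) \<partial>M)"
        using measurable_compose[OF V measurable_compose[OF c b]] by (simp add: nn_integral_cmult)
      also have "\<dots> = (\<integral>\<^sup>+\<omega>. ?a (X \<omega>) \<partial>M) * (\<integral>\<^sup>+\<omega>. ?b (\<Psi> (Z z, V \<omega>)) \<partial>M)"
        using measurable_compose[OF X a] by (simp add: nn_integral_multc)
      finally show ?thesis .
    qed
    have aX: "(\<lambda>w. ?a (X (fst w))) \<in> borel_measurable (M \<Otimes>\<^sub>M L)" by (rule measurable_compose[OF X' a])
    have bW: "(\<lambda>w. ?b (?W w)) \<in> borel_measurable (M \<Otimes>\<^sub>M L)" by (rule measurable_compose[OF W b])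
    have ia: "(\<integral>\<^sup>+w. ?a (X (fst w)) \<partial>(M \<Otimes>\<^sub>M L)) = (\<integral>\<^sup>+\<omega>. ?a (X \<omega>) \<partial>M)"
      using nn_integral_snd[OF aX] by (simp add: L.emeasure_space_1)
    have ib: "(\<integral>\<^sup>+w. ?b (?W w) \<partial>(M \<Otimes>\<^sub>M L)) = (\<integral>\<^sup>+z. \<integral>\<^sup>+\<omega>. ?b (\<Psi> (Z z, V \<omega>)) \<partial>M \<partial>L)"
      using nn_integral_snd[OF bW] by simp
    have bm: "(\<lambda>z. \<integral>\<^sup>+\<omega>. ?b (\<Psi> (Z z, V \<omega>)) \<partial>M) \<in> borel_measurable L"
    proof (rule M.borel_measurable_nn_integral[of "\<lambda>z \<omega>. ?b (\<Psi> (Z z, V \<omega>))"])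
      show "(\<lambda>(z, \<omega>). ?b (\<Psi> (Z z, V \<omega>))) \<in> borel_measurable (L \<Otimes>\<^sub>M M)"
        unfolding case_prod_beta
        by (intro measurable_compose[OF _ b] measurable_compose[OF _ \<Psi>] measurable_Pair
            measurable_compose[OF measurable_fst Z] measurable_compose[OF measurable_snd V])
    qed
    have "emeasure (distr (M \<Otimes>\<^sub>M L) (S \<Otimes>\<^sub>M R) (\<lambda>w. ((X \<circ> fst) w, ?W w))) (A \<times> B)
        = (\<integral>\<^sup>+w. indicator (A \<times> B) ((X \<circ> fst) w, ?W w) \<partial>(M \<Otimes>\<^sub>M L))"
      using A B by (intro emeasure_distr_indicator measurable_Pair Xf W) auto
    also have "\<dots> = (\<integral>\<^sup>+w. ?a (X (fst w)) * ?b (?W w) \<partial>(M \<Otimes>\<^sub>M L))"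
      by (simp add: indicator_times)
    also have "\<dots> = (\<integral>\<^sup>+z. \<integral>\<^sup>+\<omega>. ?a (X \<omega>) * ?b (\<Psi> (Z z, V \<omega>)) \<partial>M \<partial>L)"
      using nn_integral_snd[OF borel_measurable_times_ennreal[OF aX bW]] by simp
    also have "\<dots> = (\<integral>\<^sup>+z. (\<integral>\<^sup>+\<omega>. ?a (X \<omega>) \<partial>M) * (\<integral>\<^sup>+\<omega>. ?b (\<Psi> (Z z, V \<omega>)) \<partial>M) \<partial>L)"
      by (intro nn_integral_cong inner)
    also have "\<dots> = (\<integral>\<^sup>+w. ?a (X (fst w)) \<partial>(M \<Otimes>\<^sub>M L)) * (\<integral>\<^sup>+w. ?b (?W w) \<partial>(M \<Otimes>\<^sub>M L))"
      unfolding ia ib by (rule nn_integral_cmult[OF bm])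
    also have "\<dots> = emeasure (distr (M \<Otimes>\<^sub>M L) S (X \<circ> fst)) A * emeasure (distr (M \<Otimes>\<^sub>M L) R ?W) B"
    proof -
      have "emeasure (distr (M \<Otimes>\<^sub>M L) S (X \<circ> fst)) A = (\<integral>\<^sup>+w. ?a (X (fst w)) \<partial>(M \<Otimes>\<^sub>M L))"
        using emeasure_distr_indicator[OF Xf A] by simp
      moreover have "emeasure (distr (M \<Otimes>\<^sub>M L) R ?W) B = (\<integral>\<^sup>+w. ?b (?W w) \<partial>(M \<Otimes>\<^sub>M L))"
        by (rule emeasure_distr_indicator[OF W B])
      ultimately show ?thesis by simp
    qed
    finally show "emeasure (distr (M \<Otimes>\<^sub>M L) S (X \<circ> fst)) A * emeasure (distr (M \<Otimes>\<^sub>M L) R ?W) B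
        = emeasure (distr (M \<Otimes>\<^sub>M L) (S \<Otimes>\<^sub>M R) (\<lambda>w. ((X \<circ> fst) w, ?W w))) (A \<times> B)" by simp
  next
    show "sigma_finite_measure (distr (M \<Otimes>\<^sub>M L) S (X \<circ> fst))"
      by (rule prob_space_imp_sigma_finite[OF prob_space_distr[OF Xf]])
    show "sigma_finite_measure (distr (M \<Otimes>\<^sub>M L) R ?W)"
      by (rule prob_space_imp_sigma_finite[OF prob_space_distr[OF W]])
    show "sets (distr (M \<Otimes>\<^sub>M L) S (X \<circ> fst) \<Otimes>\<^sub>M distr (M \<Otimes>\<^sub>M L) R ?W)
        = sets (distr (M \<Otimes>\<^sub>M L) (S \<Otimes>\<^sub>M R) (\<lambda>w. ((X \<circ> fst) w, ?W w)))"
      by (simp cong: sets_pair_measure_cong)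
  qed
  thus ?thesis using Xf W by (simp add: indep_var_distribution_eq)
qed

section \<open>The product space and the copy\<close>

context nonlinear_ar
begin

abbreviation path_space :: "int set \<Rightarrow> (int \<Rightarrow> nat \<Rightarrow> real) measure" where
  "path_space J \<equiv> PiM J (\<lambda>_. vec_borel p)"

text \<open>The law of the whole path is used although a copy reads coordinate \<open>j\<close>
  only. Thus one space serves every \<open>j\<close> and has the type required of the
  extension.\<close>

definition copy_space :: "(int \<Rightarrow> nat \<Rightarrow> real) measure" where
  "copy_space = distr M (path_space UNIV) (\<lambda>\<omega> t. Y t \<omega>)"

abbreviation coupled_space :: "('a \<times> (int \<Rightarrow> nat \<Rightarrow> real)) measure" where
  "coupled_space \<equiv> M \<Otimes>\<^sub>M copy_space"

text \<open>The start comes from the second factor, the noise from the first. For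
  \<open>t < j\<close> the truncation in \<open>nat (t - j)\<close> returns the start;
  \<open>independent_copy_after\<close> looks at \<open>t > j\<close> only.\<close>

definition copy :: "int \<Rightarrow> int \<Rightarrow> 'a \<times> (int \<Rightarrow> nat \<Rightarrow> real) \<Rightarrow> nat \<Rightarrow> real" where
  "copy j t w = traj j (snd w j) (\<lambda>s. E s (fst w)) (nat (t - j))"

lemma copy_start: "copy j j w = snd w j"
  by (simp add: copy_def)

lemma copy_step: "copy j (j + int n + 1) w = step (copy j (j + int n) w) (E (j + int n + 1) (fst w))"
proof -
  have "nat (j + int n + 1 - j) = Suc n" by simp
  thus ?thesis by (simp add: copy_def)
qed

lemma Y_path_measurable: "(\<lambda>\<omega> t. Y t \<omega>) \<in> M \<rightarrow>\<^sub>M path_space UNIV"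
proof -
  have "(\<lambda>\<omega>. \<lambda>t\<in>UNIV. Y t \<omega>) \<in> M \<rightarrow>\<^sub>M path_space UNIV" by (intro measurable_restrict Y_measurable)
  thus ?thesis by (simp only: restrict_UNIV)
qed

lemma prob_space_copy: "prob_space copy_space"
  unfolding copy_space_def by (rule prob_space_distr[OF Y_path_measurable])

lemma copy_space_component: "(\<lambda>z. z j) \<in> copy_space \<rightarrow>\<^sub>M vec_borel p"
  unfolding copy_space_def by (simp add: restrict_measurable_component)

lemma copy_space_in_vecs: "z \<in> space copy_space \<Longrightarrow> z j \<in> vecs p"
  using measurable_space[OF copy_space_component] by (simp add: space_PiM)

lemma prob_extension_coupled: "prob_extension M coupled_space"
proof -
  interpret L: prob_space copy_space by (rule prob_space_copy)
  interpret pair_prob_space M copy_space ..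
  show ?thesis unfolding prob_extension_def
    using prob_space_axioms L.distr_pair_fst by auto
qed

lemma nn_integral_coupled:
  assumes "f \<in> borel_measurable coupled_space"
  shows "(\<integral>\<^sup>+w. f w \<partial>coupled_space) = (\<integral>\<^sup>+z. \<integral>\<^sup>+\<omega>. f (\<omega>, z) \<partial>M \<partial>copy_space)"
proof -
  interpret L: prob_space copy_space by (rule prob_space_copy)
  interpret pair_prob_space M copy_space ..
  show ?thesis using nn_integral_snd[OF assms] by simp
qed

lemma nn_integral_coupled_fst:
  assumes "f \<in> borel_measurable M"
  shows "(\<integral>\<^sup>+w. f (fst w) \<partial>coupled_space) = (\<integral>\<^sup>+\<omega>. f \<omega> \<partial>M)"
  using assms prob_space.emeasure_space_1[OF prob_space_copy] by (subst nn_integral_coupled) auto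

lemma nn_integral_copy_space:
  assumes "f \<in> borel_measurable (vec_borel p)"
  shows "(\<integral>\<^sup>+z. f (z j) \<partial>copy_space) = (\<integral>\<^sup>+\<omega>. f (Y j \<omega>) \<partial>M)"
  unfolding copy_space_def
  by (rule nn_integral_distr[OF Y_path_measurable])
    (use measurable_compose[OF restrict_measurable_component[of j UNIV] assms] in simp)

lemma nn_integral_coupled_snd:
  assumes "f \<in> borel_measurable (vec_borel p)"
  shows "(\<integral>\<^sup>+w. f (snd w j) \<partial>coupled_space) = (\<integral>\<^sup>+\<omega>. f (Y j \<omega>) \<partial>M)"
  using measurable_compose[OF measurable_compose[OF measurable_snd copy_space_component] assms]
  by (subst nn_integral_coupled) (auto simp: emeasure_space_1 nn_integral_copy_space[OF assms])

lemma AE_coupled_fst: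
  assumes "AE \<omega> in M. P \<omega>"
  shows "AE w in coupled_space. P (fst w)"
proof -
  have "distr coupled_space M fst = M"
    using prob_extension_coupled by (simp add: prob_extension_def)
  with assms have "AE \<omega> in distr coupled_space M fst. P \<omega>" by (simp only:)
  thus ?thesis by (rule AE_distrD[OF measurable_fst])
qed

lemma Y_fst_measurable [measurable]: "(\<lambda>w. Y t (fst w)) \<in> coupled_space \<rightarrow>\<^sub>M vec_borel p"
  by (rule measurable_compose[OF measurable_fst Y_measurable])

lemma E_fst_measurable [measurable]: "(\<lambda>w. E t (fst w)) \<in> coupled_space \<rightarrow>\<^sub>M vec_borel p"
  by (rule measurable_compose[OF measurable_fst E_measurable])

lemma copy_measurable [measurable]: "copy j t \<in> coupled_space \<rightarrow>\<^sub>M vec_borel p"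
  unfolding copy_def
  by (intro traj_measurable measurable_compose[OF measurable_snd copy_space_component] E_fst_measurable)

lemma coupled_diff_step:
  "AE w in coupled_space. \<forall>i<p. Y (j + int n + 1) (fst w) i - copy j (j + int n + 1) w i
    = step (Y (j + int n) (fst w)) (E (j + int n + 1) (fst w)) i - step (copy j (j + int n) w) (E (j + int n + 1) (fst w)) i"
  using AE_coupled_fst[OF Y_eq_step]
proof eventually_elim
  case (elim w)
  have "Y (j + int n + 1) (fst w) = step (Y (j + int n + 1 - 1) (fst w)) (E (j + int n + 1) (fst w))" using elim by blast
  thus ?case by (simp add: copy_step)
qed

text \<open>Given its initial value, the copy is a function of the noise on \<open>M\<close> alone. Hence \<open>E (k + 1)\<close> is
  independent of the pair of states at time \<open>k\<close>, and a bound for frozen states can be integrated.\<close>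

lemma nn_integral_coupled_step:
  assumes causal: "AE \<omega> in M. \<forall>t. Y t \<omega> = limit_map t (\<lambda>s. E s \<omega>)"
    and f: "f \<in> borel_measurable ((vec_borel p \<Otimes>\<^sub>M vec_borel p) \<Otimes>\<^sub>M vec_borel p)"
    and g: "g \<in> borel_measurable (vec_borel p \<Otimes>\<^sub>M vec_borel p)"
    and le: "\<And>y y'. y \<in> vecs p \<Longrightarrow> y' \<in> vecs p \<Longrightarrow> (\<integral>\<^sup>+\<omega>. f ((y, y'), E (j + int n + 1) \<omega>) \<partial>M) \<le> g (y, y')"
  shows "(\<integral>\<^sup>+w. f ((Y (j + int n) (fst w), copy j (j + int n) w), E (j + int n + 1) (fst w)) \<partial>coupled_space)
    \<le> (\<integral>\<^sup>+w. g (Y (j + int n) (fst w), copy j (j + int n) w) \<partial>coupled_space)"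
proof -
  let ?k = "j + int n"
  have fm: "(\<lambda>w. f ((Y ?k (fst w), copy j ?k w), E (?k + 1) (fst w))) \<in> borel_measurable coupled_space"
    by (intro measurable_compose[OF _ f] measurable_Pair Y_fst_measurable copy_measurable E_fst_measurable)
  have gm: "(\<lambda>w. g (Y ?k (fst w), copy j ?k w)) \<in> borel_measurable coupled_space"
    by (intro measurable_compose[OF _ g] measurable_Pair Y_fst_measurable copy_measurable)
  have "(\<integral>\<^sup>+\<omega>. f ((Y ?k \<omega>, traj j (z j) (\<lambda>s. E s \<omega>) n), E (?k + 1) \<omega>) \<partial>M)
      \<le> (\<integral>\<^sup>+\<omega>. g (Y ?k \<omega>, traj j (z j) (\<lambda>s. E s \<omega>) n) \<partial>M)" if "z \<in> space copy_space" for z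
    unfolding pair_nn_integral[OF causal copy_space_in_vecs[OF that] f]
    by (intro nn_integral_mono le Y_in_vecs traj_in_vecs copy_space_in_vecs that)
  hence "(\<integral>\<^sup>+z. \<integral>\<^sup>+\<omega>. f ((Y ?k \<omega>, copy j ?k (\<omega>, z)), E (?k + 1) \<omega>) \<partial>M \<partial>copy_space)
      \<le> (\<integral>\<^sup>+z. \<integral>\<^sup>+\<omega>. g (Y ?k \<omega>, copy j ?k (\<omega>, z)) \<partial>M \<partial>copy_space)"
    by - (rule nn_integral_mono, simp add: copy_def)
  thus ?thesis using nn_integral_coupled[OF fm] nn_integral_coupled[OF gm] by simp
qed

lemma lq_bounded_coupled_step:
  assumes causal: "AE \<omega> in M. \<forall>t. Y t \<omega> = limit_map t (\<lambda>s. E s \<omega>)"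
    and f: "f \<in> borel_measurable ((vec_borel p \<Otimes>\<^sub>M vec_borel p) \<Otimes>\<^sub>M vec_borel p)"
    and c: "0 \<le> c"
    and le: "\<And>y y'. y \<in> vecs p \<Longrightarrow> y' \<in> vecs p \<Longrightarrow>
      lq_bounded M q (\<lambda>\<omega>. f ((y, y'), E (j + int n + 1) \<omega>)) (c * L2_set (\<lambda>i. y i - y' i) {..<p})"
    and d: "lq_bounded coupled_space q (\<lambda>w. L2_set (\<lambda>i. Y (j + int n) (fst w) i - copy j (j + int n) w i) {..<p}) d" "0 \<le> d"
  shows "lq_bounded coupled_space q (\<lambda>w. f ((Y (j + int n) (fst w), copy j (j + int n) w), E (j + int n + 1) (fst w))) (c * d)"
proof -
  let ?g = "\<lambda>(y, y'). ennreal (\<bar>c * L2_set (\<lambda>i. y i - y' i) {..<p}\<bar> powr q)"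
  have "(\<integral>\<^sup>+w. ennreal (\<bar>f ((Y (j + int n) (fst w), copy j (j + int n) w), E (j + int n + 1) (fst w))\<bar> powr q) \<partial>coupled_space)
      \<le> (\<integral>\<^sup>+w. ?g (Y (j + int n) (fst w), copy j (j + int n) w) \<partial>coupled_space)"
  proof (rule nn_integral_coupled_step[OF causal, where f = "\<lambda>x. ennreal (\<bar>f x\<bar> powr q)"])
    show "?g \<in> borel_measurable (vec_borel p \<Otimes>\<^sub>M vec_borel p)"
      unfolding case_prod_beta by measurable
    fix y y' assume "y \<in> vecs p" "y' \<in> vecs p"
    from le[OF this] show "(\<integral>\<^sup>+\<omega>. ennreal (\<bar>f ((y, y'), E (j + int n + 1) \<omega>)\<bar> powr q) \<partial>M) \<le> ?g (y, y')"
      using c by (simp add: lq_bounded_def)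
  qed (use f in measurable)
  moreover have "lq_bounded coupled_space q (\<lambda>w. c * L2_set (\<lambda>i. Y (j + int n) (fst w) i - copy j (j + int n) w i) {..<p}) (\<bar>c\<bar> * d)"
    by (rule lq_bounded_mult[OF d measurable_L2_set_diff[OF Y_fst_measurable copy_measurable]])
  ultimately show ?thesis using c unfolding lq_bounded_def by simp
qed

section \<open>Geometric decay of the distance and of its projections\<close>

lemma lq_bounded_diff:
  assumes causal: "AE \<omega> in M. \<forall>t. Y t \<omega> = limit_map t (\<lambda>s. E s \<omega>)"
    and q: "1 \<le> q" "q \<le> 5"
    and \<kappa>: "sup_psi2 M p (sign_vectors p) Y \<le> ennreal \<kappa>" "0 \<le> \<kappa>"
  shows "lq_bounded coupled_space q (\<lambda>w. L2_set (\<lambda>i. Y (j + int n) (fst w) i - copy j (j + int n) w i) {..<p})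
    (2 * \<kappa> * (a\<^sub>1 + a\<^sub>2) ^ n)"
proof (induction n)
  case 0
  have Y: "lq_bounded M q (\<lambda>\<omega>. L2_set (Y j \<omega>) {..<p}) \<kappa>" by (rule lq_bounded_vec[OF Y_measurable \<kappa> q])
  have "lq_bounded coupled_space q (\<lambda>w. L2_set (Y j (fst w)) {..<p}) \<kappa>"
    using Y unfolding lq_bounded_def
    by (subst nn_integral_coupled_fst[where f = "\<lambda>\<omega>. ennreal (\<bar>L2_set (Y j \<omega>) {..<p}\<bar> powr q)"]) auto
  moreover have "lq_bounded coupled_space q (\<lambda>w. L2_set (snd w j) {..<p}) \<kappa>"
    using Y unfolding lq_bounded_def
    by (subst nn_integral_coupled_snd[where f = "\<lambda>y. ennreal (\<bar>L2_set y {..<p}\<bar> powr q)"]) auto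
  moreover have "(\<lambda>w. snd w j) \<in> coupled_space \<rightarrow>\<^sub>M vec_borel p"
    by (rule measurable_compose[OF measurable_snd copy_space_component])
  ultimately have "lq_bounded coupled_space q (\<lambda>w. L2_set (\<lambda>i. Y j (fst w) i - copy j j w i) {..<p}) (\<kappa> + \<kappa>)"
    by (intro lq_bounded_add[OF q(1), where X = "\<lambda>w. L2_set (Y j (fst w)) {..<p}" and Y = "\<lambda>w. L2_set (snd w j) {..<p}"])
      (auto simp: \<kappa> copy_start L2_set_diff_le)
  thus ?case by simp
next
  case (Suc n)
  let ?\<rho> = "a\<^sub>1 + a\<^sub>2" and ?k = "j + int n"
  let ?f = "\<lambda>((y, y'), e). L2_set (\<lambda>i. step y e i - step y' e i) {..<p}"
  have "lq_bounded coupled_space q (\<lambda>w. ?f ((Y ?k (fst w), copy j ?k w), E (?k + 1) (fst w))) (?\<rho> * (2 * \<kappa> * ?\<rho> ^ n))"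
  proof (rule lq_bounded_coupled_step[OF causal])
    show "?f \<in> borel_measurable ((vec_borel p \<Otimes>\<^sub>M vec_borel p) \<Otimes>\<^sub>M vec_borel p)"
      unfolding case_prod_beta
      by (intro measurable_L2_set_diff step_measurable measurable_snd
          measurable_compose[OF measurable_fst measurable_fst] measurable_compose[OF measurable_fst measurable_snd])
    fix y y' assume y: "y \<in> vecs p" "y' \<in> vecs p"
    let ?d = "L2_set (\<lambda>i. y i - y' i) {..<p}"
    have "lq_bounded M q (\<lambda>\<omega>. ?d * gain (E (?k + 1) \<omega>)) (\<bar>?d\<bar> * ?\<rho>)"
      using rho_pos by (intro lq_bounded_mult lq_bounded_gain q) auto
    moreover have "AE \<omega> in M. \<bar>?f ((y, y'), E (?k + 1) \<omega>)\<bar> \<le> \<bar>?d * gain (E (?k + 1) \<omega>)\<bar>"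
    proof (intro AE_I2)
      fix \<omega>
      show "\<bar>?f ((y, y'), E (?k + 1) \<omega>)\<bar> \<le> \<bar>?d * gain (E (?k + 1) \<omega>)\<bar>"
        using step_contraction[OF y, of "E (?k + 1) \<omega>"] by (simp add: gain_nonneg mult.commute[of ?d])
    qed
    ultimately have "lq_bounded M q (\<lambda>\<omega>. ?f ((y, y'), E (?k + 1) \<omega>)) (\<bar>?d\<bar> * ?\<rho>)"
      by (rule lq_bounded_mono) (use q in simp)
    thus "lq_bounded M q (\<lambda>\<omega>. ?f ((y, y'), E (?k + 1) \<omega>)) (?\<rho> * ?d)" by (simp add: mult.commute)
  qed (use Suc rho_pos \<kappa> in auto)
  moreover have "AE w in coupled_space. \<bar>L2_set (\<lambda>i. Y (?k + 1) (fst w) i - copy j (?k + 1) w i) {..<p}\<bar>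
      \<le> \<bar>?f ((Y ?k (fst w), copy j ?k w), E (?k + 1) (fst w))\<bar>"
    using coupled_diff_step[of j n]
  proof eventually_elim
    case (elim w)
    have "L2_set (\<lambda>i. Y (?k + 1) (fst w) i - copy j (?k + 1) w i) {..<p}
        = ?f ((Y ?k (fst w), copy j ?k w), E (?k + 1) (fst w))"
      unfolding prod.case by (rule L2_set_cong[OF refl]) (use elim in blast)
    thus ?case by (simp only: order_refl)
  qed
  ultimately have "lq_bounded coupled_space q (\<lambda>w. L2_set (\<lambda>i. Y (?k + 1) (fst w) i - copy j (?k + 1) w i) {..<p}) (?\<rho> * (2 * \<kappa> * ?\<rho> ^ n))"
    by (rule lq_bounded_mono) (use q in simp)
  thus ?case by (simp add: algebra_simps)
qed

text \<open>One step turns the projection on \<open>u\<close> into the projection of the old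
  difference on the transposed image of \<open>u\<close> under \<open>A\<close>, plus a noise term.
  As the direction changes, the induction runs over all \<open>u\<close>. For frozen states the
  noise term projects the noise on the transposed image of \<open>u\<close> under the change of
  \<open>H\<close>, so \<open>\<kappa>\<^sub>1'\<close> applies, and \<open>lq_bounded_diff\<close>
  then bounds the distance. The second condition on \<open>R\<close> makes this at most
  \<open>a\<^sub>2\<close> times the old bound, while the first term contributes
  \<open>a\<^sub>1\<close> times it.\<close>

lemma lq_bounded_projected_diff:
  assumes causal: "AE \<omega> in M. \<forall>t. Y t \<omega> = limit_map t (\<lambda>s. E s \<omega>)"
    and q: "1 \<le> q" "q \<le> 5"
    and \<kappa>: "sup_psi2 M p (sign_vectors p) Y \<le> ennreal \<kappa>" "0 \<le> \<kappa>"
    and \<kappa>1: "sup_psi2 M p (unit_sphere p) Y \<le> ennreal \<kappa>1" "0 \<le> \<kappa>1"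
    and R: "\<kappa>1 \<le> R" "\<kappa> * \<kappa>\<^sub>1' / \<kappa>\<^sub>s' \<le> R"
  shows "lq_bounded coupled_space q (\<lambda>w. inner_vec p u (\<lambda>i. Y (j + int n) (fst w) i - copy j (j + int n) w i))
    (L2_set u {..<p} * (2 * R * (a\<^sub>1 + a\<^sub>2) ^ n))"
proof (induction n arbitrary: u)
  case 0
  let ?u = "L2_set u {..<p}"
  have R0: "0 \<le> R" using R \<kappa>1 by simp
  have Y: "lq_bounded M q (\<lambda>\<omega>. inner_vec p u (Y j \<omega>)) (?u * R)"
    by (rule lq_bounded_weaken[OF lq_bounded_projection[OF Y_measurable \<kappa>1 q]])
      (use R \<kappa>1 q in \<open>auto intro: mult_left_mono\<close>)
  have "lq_bounded coupled_space q (\<lambda>w. inner_vec p u (Y j (fst w))) (?u * R)"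
    using Y unfolding lq_bounded_def
    by (subst nn_integral_coupled_fst[where f = "\<lambda>\<omega>. ennreal (\<bar>inner_vec p u (Y j \<omega>)\<bar> powr q)"]) auto
  moreover have "lq_bounded coupled_space q (\<lambda>w. inner_vec p u (snd w j)) (?u * R)"
    using Y unfolding lq_bounded_def
    by (subst nn_integral_coupled_snd[where f = "\<lambda>y. ennreal (\<bar>inner_vec p u y\<bar> powr q)"]) auto
  moreover have "(\<lambda>w. snd w j) \<in> coupled_space \<rightarrow>\<^sub>M vec_borel p"
    by (rule measurable_compose[OF measurable_snd copy_space_component])
  ultimately have "lq_bounded coupled_space q (\<lambda>w. inner_vec p u (\<lambda>i. Y j (fst w) i - copy j j w i)) (?u * R + ?u * R)"
    using R0
    by (intro lq_bounded_add[OF q(1), where X = "\<lambda>w. inner_vec p u (Y j (fst w))" and Y = "\<lambda>w. inner_vec p u (snd w j)"])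
      (auto simp: copy_start inner_vec_diff_right)
  thus ?case by (simp add: algebra_simps)
next
  case (Suc n)
  let ?\<rho> = "a\<^sub>1 + a\<^sub>2" and ?k = "j + int n"
  let ?u = "L2_set u {..<p}"
  let ?\<Delta> = "\<lambda>y y' i k. H y i k - H y' i k"
  let ?f = "\<lambda>((y, y'), e). inner_vec p u (mat_vec p (?\<Delta> y y') e)"
  let ?c = "a\<^sub>2 / \<kappa>\<^sub>s' * ?u * \<kappa>\<^sub>1'"
  let ?Au = "mat_vec p (\<lambda>i j. A j i) u"
  let ?D = "\<lambda>t w i. Y t (fst w) i - copy j t w i"
  have R0: "0 \<le> R" using R \<kappa>1 by simp
  have c0: "0 \<le> ?c" using contraction kappa_pos by simp
  have fm: "?f \<in> borel_measurable ((vec_borel p \<Otimes>\<^sub>M vec_borel p) \<Otimes>\<^sub>M vec_borel p)"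
  proof -
    have "(\<lambda>x. H (fst (fst x)) i k) \<in> borel_measurable ((vec_borel p \<Otimes>\<^sub>M vec_borel p) \<Otimes>\<^sub>M vec_borel p)"
      "(\<lambda>x. H (snd (fst x)) i k) \<in> borel_measurable ((vec_borel p \<Otimes>\<^sub>M vec_borel p) \<Otimes>\<^sub>M vec_borel p)"
      "(\<lambda>x. snd x k) \<in> borel_measurable ((vec_borel p \<Otimes>\<^sub>M vec_borel p) \<Otimes>\<^sub>M vec_borel p)"
      if "i < p" "k < p" for i k
      using H_entry_measurable[OF that] that by measurable
    thus ?thesis unfolding case_prod_beta mat_vec_def
      by (intro measurable_inner_vec measurable_vecI borel_measurable_sum borel_measurable_times borel_measurable_diff) auto
  qed
  have noise: "lq_bounded coupled_space q (\<lambda>w. ?f ((Y ?k (fst w), copy j ?k w), E (?k + 1) (fst w))) (?c * (2 * \<kappa> * ?\<rho> ^ n))"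
  proof (rule lq_bounded_coupled_step[OF causal fm c0])
    fix y y' assume y: "y \<in> vecs p" "y' \<in> vecs p"
    let ?w = "mat_vec p (\<lambda>i k. ?\<Delta> y y' k i) u"
    have "lq_bounded M q (\<lambda>\<omega>. inner_vec p ?w (E (?k + 1) \<omega>)) (L2_set ?w {..<p} * \<kappa>\<^sub>1')"
      using kappa_pos by (intro lq_bounded_projection q E_psi2_unit) auto
    moreover have "0 \<le> L2_set ?w {..<p} * \<kappa>\<^sub>1'" using kappa_pos by simp
    moreover have "L2_set ?w {..<p} * \<kappa>\<^sub>1' \<le> ?c * L2_set (\<lambda>i. y i - y' i) {..<p}"
    proof -
      have "L2_set ?w {..<p} \<le> spectral_norm p (?\<Delta> y y') * ?u"
        by (rule L2_set_mat_vec_transpose_le[OF dim_pos])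
      also have "\<dots> \<le> (a\<^sub>2 / \<kappa>\<^sub>s' * L2_set (\<lambda>i. y i - y' i) {..<p}) * ?u"
        by (intro mult_right_mono H_lipschitz y) auto
      finally have "L2_set ?w {..<p} * \<kappa>\<^sub>1' \<le> (a\<^sub>2 / \<kappa>\<^sub>s' * L2_set (\<lambda>i. y i - y' i) {..<p}) * ?u * \<kappa>\<^sub>1'"
        using kappa_pos by (intro mult_right_mono) auto
      thus ?thesis by (simp add: mult_ac)
    qed
    ultimately have "lq_bounded M q (\<lambda>\<omega>. inner_vec p ?w (E (?k + 1) \<omega>)) (?c * L2_set (\<lambda>i. y i - y' i) {..<p})"
      by (rule lq_bounded_weaken) (use q in simp)
    thus "lq_bounded M q (\<lambda>\<omega>. ?f ((y, y'), E (?k + 1) \<omega>)) (?c * L2_set (\<lambda>i. y i - y' i) {..<p})"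
      by (simp add: inner_vec_mat_vec)
  qed (use lq_bounded_diff[OF causal q \<kappa>] \<kappa> rho_pos in auto)
  have nonneg: "0 \<le> L2_set ?Au {..<p} * (2 * R * ?\<rho> ^ n)" "0 \<le> ?c * (2 * \<kappa> * ?\<rho> ^ n)"
    using R0 rho_pos \<kappa> contraction kappa_pos by (intro mult_nonneg_nonneg zero_le_power; simp)+
  have "lq_bounded coupled_space q (\<lambda>w. inner_vec p u (?D (?k + 1) w))
      (L2_set ?Au {..<p} * (2 * R * ?\<rho> ^ n) + ?c * (2 * \<kappa> * ?\<rho> ^ n))"
  proof (rule lq_bounded_add[OF q(1) _ _ Suc.IH[of ?Au] noise])
    show "(\<lambda>w. inner_vec p ?Au (?D ?k w)) \<in> borel_measurable coupled_space"
      unfolding inner_vec_diff_right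
      by (intro borel_measurable_diff measurable_inner_vec Y_fst_measurable copy_measurable)
    show "(\<lambda>w. ?f ((Y ?k (fst w), copy j ?k w), E (?k + 1) (fst w))) \<in> borel_measurable coupled_space"
      by (intro measurable_compose[OF _ fm] measurable_Pair Y_fst_measurable copy_measurable E_fst_measurable)
    show "AE w in coupled_space. \<bar>inner_vec p u (?D (?k + 1) w)\<bar>
      \<le> \<bar>inner_vec p ?Au (?D ?k w)\<bar> + \<bar>?f ((Y ?k (fst w), copy j ?k w), E (?k + 1) (fst w))\<bar>"
      using coupled_diff_step[of j n]
    proof eventually_elim
      case (elim w)
      let ?e = "E (?k + 1) (fst w)"
      have "inner_vec p u (?D (?k + 1) w)
          = inner_vec p u (\<lambda>i. mat_vec p A (?D ?k w) i + mat_vec p (?\<Delta> (Y ?k (fst w)) (copy j ?k w)) ?e i)"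
        unfolding inner_vec_def using elim step_diff by (intro sum.cong) auto
      also have "\<dots> = inner_vec p u (mat_vec p A (?D ?k w)) + ?f ((Y ?k (fst w), copy j ?k w), ?e)"
        by (simp add: inner_vec_def sum.distrib algebra_simps)
      finally show ?case by (simp add: inner_vec_mat_vec)
    qed
  qed (intro nonneg)+
  moreover note add_nonneg_nonneg[OF nonneg]
  moreover have "L2_set ?Au {..<p} * (2 * R * ?\<rho> ^ n) + ?c * (2 * \<kappa> * ?\<rho> ^ n) \<le> ?u * (2 * R * ?\<rho> ^ Suc n)"
  proof -
    have "L2_set ?Au {..<p} \<le> spectral_norm p A * ?u" by (rule L2_set_mat_vec_transpose_le[OF dim_pos])
    also have "\<dots> \<le> a\<^sub>1 * ?u" using A_norm by (intro mult_right_mono) auto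
    finally have "L2_set ?Au {..<p} * (2 * R * ?\<rho> ^ n) \<le> a\<^sub>1 * ?u * (2 * R * ?\<rho> ^ n)"
      using R0 rho_pos by (intro mult_right_mono) auto
    moreover have "?c * (2 * \<kappa> * ?\<rho> ^ n) = a\<^sub>2 * ?u * (2 * (\<kappa> * \<kappa>\<^sub>1' / \<kappa>\<^sub>s') * ?\<rho> ^ n)" by (simp add: mult_ac)
    moreover have "\<dots> \<le> a\<^sub>2 * ?u * (2 * R * ?\<rho> ^ n)"
      using R contraction rho_pos by (intro mult_left_mono mult_right_mono) auto
    ultimately show ?thesis by (simp add: algebra_simps)
  qed
  ultimately have "lq_bounded coupled_space q (\<lambda>w. inner_vec p u (?D (?k + 1) w)) (?u * (2 * R * ?\<rho> ^ Suc n))"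
    by (rule lq_bounded_weaken) (use q in simp)
  thus ?case by (simp add: add.commute add.left_commute)
qed

text \<open>After time \<open>j\<close>, both \<open>Y\<close> and the copy are the same function
  \<open>\<Psi>\<close> of a start and the noise after \<open>j\<close>. In both cases the start has
  the law of \<open>Y j\<close> and is independent of that noise, so the laws agree. Independence
  from the past of \<open>Y\<close> holds because this past is independent of the later noise and
  the other start lives on the second factor.\<close>

lemma independent_copy_coupled:
  assumes causal: "AE \<omega> in M. \<forall>t. Y t \<omega> = limit_map t (\<lambda>s. E s \<omega>)"
  shows "independent_copy_after coupled_space p j (\<lambda>t. Y t \<circ> fst) (copy j)"
  unfolding independent_copy_after_def
proof (intro conjI allI impI)
  fix t show "copy j t \<in> coupled_space \<rightarrow>\<^sub>M vec_borel p" by (rule copy_measurable)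
next
  let ?S = "path_space {..j}" and ?T = "path_space {j<..}"
  define \<Psi> where "\<Psi> = (\<lambda>(y, v). \<lambda>t\<in>{j<..}. traj j y v (nat (t - j)))"
  have \<Psi>: "\<Psi> \<in> vec_borel p \<Otimes>\<^sub>M ?T \<rightarrow>\<^sub>M ?T"
    unfolding \<Psi>_def case_prod_beta
    by (intro measurable_restrict traj_measurable measurable_fst
        measurable_compose[OF measurable_snd restrict_measurable_component]) auto
  let ?X = "\<lambda>\<omega>. \<lambda>t\<in>{..j}. Y t \<omega>" and ?V = "\<lambda>\<omega>. \<lambda>t\<in>{j<..}. E t \<omega>"
  note ind = Y_past_indep[OF causal, of j]
  have copy: "(\<lambda>w. \<lambda>t\<in>{j<..}. copy j t w) = (\<lambda>w. \<Psi> (snd w j, ?V (fst w)))"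
    unfolding \<Psi>_def copy_def prod.case
    by (rule ext, rule restrict_ext, rule traj_cong) auto
  show "prob_space.indep_var coupled_space ?S (\<lambda>w. \<lambda>t\<in>{..j}. (Y t \<circ> fst) w)
      ?T (\<lambda>w. \<lambda>t\<in>{j<..}. copy j t w)"
    using indep_var_pair_extension[OF prob_space_axioms prob_space_copy ind copy_space_component \<Psi>]
    unfolding copy by (simp add: comp_def)
  have Ym: "(\<lambda>\<omega>. \<lambda>t\<in>{j<..}. Y t \<omega>) \<in> M \<rightarrow>\<^sub>M ?T" by (intro measurable_restrict Y_measurable)
  have Vm: "?V \<in> M \<rightarrow>\<^sub>M ?T" by (intro measurable_restrict E_measurable)
  have W: "(\<lambda>w. \<Psi> (snd w j, ?V (fst w))) \<in> coupled_space \<rightarrow>\<^sub>M ?T"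
    by (intro measurable_compose[OF _ \<Psi>] measurable_Pair measurable_compose[OF measurable_snd copy_space_component]
        measurable_compose[OF measurable_fst Vm])
  have YW: "(\<lambda>\<omega>. \<Psi> (Y j \<omega>, ?V \<omega>)) \<in> M \<rightarrow>\<^sub>M ?T"
    by (intro measurable_compose[OF _ \<Psi>] measurable_Pair Y_measurable Vm)
  have "distr coupled_space ?T (\<lambda>w. \<Psi> (snd w j, ?V (fst w))) = distr M ?T (\<lambda>\<omega>. \<Psi> (Y j \<omega>, ?V \<omega>))"
  proof (rule measure_eqI)
    fix B assume "B \<in> sets (distr coupled_space ?T (\<lambda>w. \<Psi> (snd w j, ?V (fst w))))"
    hence B: "B \<in> sets ?T" by simp
    let ?b = "\<lambda>x. indicator B x :: ennreal"
    have b: "?b \<in> borel_measurable ?T" using B by simp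
    have b\<Psi>: "(\<lambda>x. ?b (\<Psi> x)) \<in> borel_measurable (vec_borel p \<Otimes>\<^sub>M ?T)" by (rule measurable_compose[OF \<Psi> b])
    have f: "(\<lambda>(x, v). ?b (\<Psi> (x j, v))) \<in> borel_measurable (?S \<Otimes>\<^sub>M ?T)"
      unfolding case_prod_beta
      by (intro measurable_compose[OF _ b\<Psi>] measurable_Pair measurable_snd
          measurable_compose[OF measurable_fst restrict_measurable_component]) auto
    have h: "(\<lambda>y. \<integral>\<^sup>+\<omega>. ?b (\<Psi> (y, ?V \<omega>)) \<partial>M) \<in> borel_measurable (vec_borel p)"
    proof (rule borel_measurable_nn_integral)
      show "(\<lambda>(y, \<omega>). ?b (\<Psi> (y, ?V \<omega>))) \<in> borel_measurable (vec_borel p \<Otimes>\<^sub>M M)"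
        unfolding case_prod_beta
        by (intro measurable_compose[OF _ b\<Psi>] measurable_Pair measurable_fst measurable_compose[OF measurable_snd Vm])
    qed
    have "emeasure (distr coupled_space ?T (\<lambda>w. \<Psi> (snd w j, ?V (fst w)))) B
        = (\<integral>\<^sup>+w. ?b (\<Psi> (snd w j, ?V (fst w))) \<partial>coupled_space)"
      by (rule emeasure_distr_indicator[OF W B])
    also have "\<dots> = (\<integral>\<^sup>+z. \<integral>\<^sup>+\<omega>. ?b (\<Psi> (z j, ?V \<omega>)) \<partial>M \<partial>copy_space)"
      using nn_integral_coupled[OF measurable_compose[OF W b]] by simp
    also have "\<dots> = (\<integral>\<^sup>+\<omega>'. \<integral>\<^sup>+\<omega>. ?b (\<Psi> (Y j \<omega>', ?V \<omega>)) \<partial>M \<partial>M)"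
      by (rule nn_integral_copy_space[OF h])
    also have "\<dots> = (\<integral>\<^sup>+\<omega>. ?b (\<Psi> (Y j \<omega>, ?V \<omega>)) \<partial>M)"
      using indep_var_nn_integral[OF ind f] by simp
    also have "\<dots> = emeasure (distr M ?T (\<lambda>\<omega>. \<Psi> (Y j \<omega>, ?V \<omega>))) B"
      by (rule emeasure_distr_indicator[OF YW B, symmetric])
    finally show "emeasure (distr coupled_space ?T (\<lambda>w. \<Psi> (snd w j, ?V (fst w)))) B
        = emeasure (distr M ?T (\<lambda>\<omega>. \<Psi> (Y j \<omega>, ?V \<omega>))) B" .
  qed simp
  also have "\<dots> = distr M ?T (\<lambda>\<omega>. \<lambda>t\<in>{j<..}. Y t \<omega>)"
  proof (rule distr_cong_AE[OF refl refl _ YW Ym])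
    show "AE \<omega> in M. \<Psi> (Y j \<omega>, ?V \<omega>) = (\<lambda>t\<in>{j<..}. Y t \<omega>)"
      using Y_eq_traj
    proof eventually_elim
      case (elim \<omega>)
      have "traj j (Y j \<omega>) (?V \<omega>) (nat (t - j)) = Y t \<omega>" if "j < t" for t
      proof -
        have "traj j (Y j \<omega>) (?V \<omega>) (nat (t - j)) = traj j (Y j \<omega>) (\<lambda>s. E s \<omega>) (nat (t - j))"
          by (rule traj_cong) auto
        also have "\<dots> = Y (j + int (nat (t - j))) \<omega>" by (rule elim[rule_format, symmetric])
        finally show ?thesis using that by simp
      qed
      thus ?case unfolding \<Psi>_def prod.case by (intro restrict_ext) (simp only: greaterThan_iff)
    qed
  qed
  also have "\<dots> = distr (distr coupled_space M fst) ?T (\<lambda>\<omega>. \<lambda>t\<in>{j<..}. Y t \<omega>)"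
    using prob_extension_coupled unfolding prob_extension_def by metis
  also have "\<dots> = distr coupled_space ?T (\<lambda>w. \<lambda>t\<in>{j<..}. (Y t \<circ> fst) w)"
    by (subst distr_distr[OF Ym measurable_fst]) (simp add: comp_def)
  finally show "distr coupled_space ?T (\<lambda>w. \<lambda>t\<in>{j<..}. copy j t w)
      = distr coupled_space ?T (\<lambda>w. \<lambda>t\<in>{j<..}. (Y t \<circ> fst) w)"
    unfolding copy .
qed

lemma coupling_bounds:
  assumes q: "1 \<le> q" "q \<le> 5"
    and fin: "sup_psi2 M p (unit_sphere p) Y < \<infinity>" "sup_psi2 M p (sign_vectors p) Y < \<infinity>"
  defines "\<kappa>1 \<equiv> enn2real (sup_psi2 M p (unit_sphere p) Y)" and "\<kappa>s \<equiv> enn2real (sup_psi2 M p (sign_vectors p) Y)"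
  shows "prob_extension M coupled_space"
    and "independent_copy_after coupled_space p j (\<lambda>t. Y t \<circ> fst) (copy j)"
    and "j + 1 \<le> k \<Longrightarrow> lq_norm coupled_space q (\<lambda>w. L2_set (\<lambda>i. Y k (fst w) i - copy j k w i) {..<p})
      \<le> ennreal (2 * (\<kappa>s / \<kappa>1) * \<kappa>1 * exp (- (- ln (a\<^sub>1 + a\<^sub>2)) * of_int (k - j - 1)))"
    and "j + 1 \<le> k \<Longrightarrow> (SUP u\<in>unit_sphere p. lq_norm coupled_space q (\<lambda>w. inner_vec p (\<lambda>i. Y k (fst w) i - copy j k w i) u))
      \<le> ennreal (2 * max (\<kappa>s * \<kappa>\<^sub>1' / (\<kappa>1 * \<kappa>\<^sub>s')) 1 * \<kappa>1 * exp (- ln (inverse (a\<^sub>1 + a\<^sub>2)) * of_int (k - j - 1)))"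
proof -
  let ?\<rho> = "a\<^sub>1 + a\<^sub>2"
  have \<kappa>: "sup_psi2 M p (unit_sphere p) Y = ennreal \<kappa>1" "sup_psi2 M p (sign_vectors p) Y = ennreal \<kappa>s"
    "0 \<le> \<kappa>1" "0 \<le> \<kappa>s"
    using fin by (auto simp: \<kappa>1_def \<kappa>s_def)
  \<comment> \<open>When \<open>\<kappa>1 = 0\<close> the claimed bounds are \<open>0\<close>, since \<open>x / 0 = 0\<close>.\<close>
  have zero: "\<kappa>s = 0" if "\<kappa>1 = 0"
    using sign_sup_psi2_eq_0 \<kappa> that by simp
  have causal: "AE \<omega> in M. \<forall>t. Y t \<omega> = limit_map t (\<lambda>s. E s \<omega>)"
    using \<kappa> by (intro Y_causal[where K = \<kappa>s] lq_bounded_vec) auto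
  show "prob_extension M coupled_space" by (rule prob_extension_coupled)
  show "independent_copy_after coupled_space p j (\<lambda>t. Y t \<circ> fst) (copy j)"
    by (rule independent_copy_coupled[OF causal])
  assume k: "j + 1 \<le> k"
  define n where "n = nat (k - j)"
  have kn: "k = j + int n" "0 < n" using k by (auto simp: n_def)
  have pow: "exp (- (- ln ?\<rho>) * of_int (k - j - 1)) = ?\<rho> ^ (n - 1)"
  proof -
    have "of_int (k - j - 1) = real (n - 1)" using kn by (simp add: of_nat_diff)
    thus ?thesis using rho_pos by (simp add: exp_of_nat2_mult)
  qed
  have pow': "exp (- ln (inverse ?\<rho>) * of_int (k - j - 1)) = ?\<rho> ^ (n - 1)"
    using pow rho_pos by (simp add: ln_inverse)
  \<comment> \<open>The induction gives the power \<open>n = k - j\<close>, the claim asks for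
    \<open>n - 1\<close>; one contraction factor is given away.\<close>
  have pow_le: "?\<rho> ^ n \<le> ?\<rho> ^ (n - 1)"
    using rho_pos contraction by (intro power_decreasing) auto
  show "lq_norm coupled_space q (\<lambda>w. L2_set (\<lambda>i. Y k (fst w) i - copy j k w i) {..<p})
      \<le> ennreal (2 * (\<kappa>s / \<kappa>1) * \<kappa>1 * exp (- (- ln ?\<rho>) * of_int (k - j - 1)))"
  proof -
    have "2 * (\<kappa>s / \<kappa>1) * \<kappa>1 = 2 * \<kappa>s" using zero by (cases "\<kappa>1 = 0") auto
    moreover have "lq_norm coupled_space q (\<lambda>w. L2_set (\<lambda>i. Y k (fst w) i - copy j k w i) {..<p})
        \<le> ennreal (2 * \<kappa>s * ?\<rho> ^ n)"
      unfolding kn(1) using q \<kappa> rho_pos by (intro lq_norm_le lq_bounded_diff[OF causal q]) auto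
    moreover have "ennreal (2 * \<kappa>s * ?\<rho> ^ n) \<le> ennreal (2 * \<kappa>s * ?\<rho> ^ (n - 1))"
      using \<kappa> pow_le by (intro ennreal_leI mult_left_mono) auto
    ultimately show ?thesis unfolding pow by (simp only: order_trans)
  qed
  show "(SUP u\<in>unit_sphere p. lq_norm coupled_space q (\<lambda>w. inner_vec p (\<lambda>i. Y k (fst w) i - copy j k w i) u))
      \<le> ennreal (2 * max (\<kappa>s * \<kappa>\<^sub>1' / (\<kappa>1 * \<kappa>\<^sub>s')) 1 * \<kappa>1 * exp (- ln (inverse ?\<rho>) * of_int (k - j - 1)))"
  proof (rule SUP_least)
    fix u assume u: "u \<in> unit_sphere p"
    \<comment> \<open>\<open>R\<close> is the claimed prefactor without its 2. The maximum is what
      makes both lower bounds on \<open>R\<close> hold at once.\<close>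
    define R where "R = max (\<kappa>s * \<kappa>\<^sub>1' / (\<kappa>1 * \<kappa>\<^sub>s')) 1 * \<kappa>1"
    have R: "\<kappa>1 \<le> R" "\<kappa>s * \<kappa>\<^sub>1' / \<kappa>\<^sub>s' \<le> R"
    proof -
      show "\<kappa>1 \<le> R" using mult_right_mono[of 1 "max (\<kappa>s * \<kappa>\<^sub>1' / (\<kappa>1 * \<kappa>\<^sub>s')) 1" \<kappa>1] \<kappa> by (simp add: R_def)
      have "\<kappa>s * \<kappa>\<^sub>1' / \<kappa>\<^sub>s' = \<kappa>s * \<kappa>\<^sub>1' / (\<kappa>1 * \<kappa>\<^sub>s') * \<kappa>1" using zero by (cases "\<kappa>1 = 0") auto
      also have "\<dots> \<le> R" unfolding R_def using \<kappa> by (intro mult_right_mono) auto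
      finally show "\<kappa>s * \<kappa>\<^sub>1' / \<kappa>\<^sub>s' \<le> R" .
    qed
    have u1: "L2_set u {..<p} = 1" using u by (simp add: unit_sphere_def)
    have "lq_bounded coupled_space q (\<lambda>w. inner_vec p u (\<lambda>i. Y k (fst w) i - copy j k w i)) (2 * R * ?\<rho> ^ n)"
      using lq_bounded_projected_diff[OF causal q _ \<kappa>(4) _ \<kappa>(3) R, of u j n] \<kappa> u1 kn by simp
    hence "lq_norm coupled_space q (\<lambda>w. inner_vec p u (\<lambda>i. Y k (fst w) i - copy j k w i)) \<le> ennreal (2 * R * ?\<rho> ^ n)"
      using q R \<kappa> rho_pos by (intro lq_norm_le) auto
    also have "\<dots> \<le> ennreal (2 * R * ?\<rho> ^ (n - 1))"
      using R \<kappa> pow_le by (intro ennreal_leI mult_left_mono) auto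
    finally show "lq_norm coupled_space q (\<lambda>w. inner_vec p (\<lambda>i. Y k (fst w) i - copy j k w i) u)
        \<le> ennreal (2 * max (\<kappa>s * \<kappa>\<^sub>1' / (\<kappa>1 * \<kappa>\<^sub>s')) 1 * \<kappa>1 * exp (- ln (inverse ?\<rho>) * of_int (k - j - 1)))"
      unfolding pow' R_def by (simp add: inner_vec_def mult_ac)
  qed
qed

end

theorem theorem3p3:
  fixes \<epsilon> :: real
  assumes "0 < \<epsilon>" and "\<epsilon> \<le> 4"
  shows "\<exists>C>0. \<exists>C'>0.
    \<forall>(M :: 'a measure) p A H E Y a\<^sub>1 a\<^sub>2 \<kappa>\<^sub>1' \<kappa>\<^sub>s'.
      nonlinear_ar M p A H E Y a\<^sub>1 a\<^sub>2 \<kappa>\<^sub>1' \<kappa>\<^sub>s' \<longrightarrow>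
        (sup_psi2 M p (unit_sphere p) Y < \<infinity> \<and> sup_psi2 M p (sign_vectors p) Y < \<infinity> \<longrightarrow>
          (let \<kappa>\<^sub>1 = enn2real (sup_psi2 M p (unit_sphere p) Y);
               \<kappa>\<^sub>s = enn2real (sup_psi2 M p (sign_vectors p) Y);
               \<gamma>\<^sub>1 = C * (\<kappa>\<^sub>s / \<kappa>\<^sub>1);
               \<gamma>\<^sub>2 = - ln (a\<^sub>1 + a\<^sub>2);
               \<gamma>\<^sub>3 = C' * max (\<kappa>\<^sub>s * \<kappa>\<^sub>1' / (\<kappa>\<^sub>1 * \<kappa>\<^sub>s')) 1;
               \<gamma>\<^sub>4 = ln (inverse (a\<^sub>1 + a\<^sub>2))
           in
             (\<forall>j. \<exists>(N :: ('a \<times> (int \<Rightarrow> nat \<Rightarrow> real)) measure) Y'.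
                prob_extension M N \<and>
                independent_copy_after N p j (\<lambda>t. Y t \<circ> fst) Y' \<and>
                (\<forall>k\<ge>j + 1.
                  lq_norm N (1 + \<epsilon>) (\<lambda>\<omega>. L2_set (\<lambda>i. Y k (fst \<omega>) i - Y' k \<omega> i) {..<p})
                  \<le> ennreal (\<gamma>\<^sub>1 * \<kappa>\<^sub>1 * exp (- \<gamma>\<^sub>2 * of_int (k - j - 1))))) \<and>
             (\<forall>j. \<exists>(N :: ('a \<times> (int \<Rightarrow> nat \<Rightarrow> real)) measure) Y'.
                prob_extension M N \<and>
                independent_copy_after N p j (\<lambda>t. Y t \<circ> fst) Y' \<and>
                (\<forall>k\<ge>j + 1.
                  (SUP u\<in>unit_sphere p.
                    lq_norm N (1 + \<epsilon>) (\<lambda>\<omega>. inner_vec p (\<lambda>i. Y k (fst \<omega>) i - Y' k \<omega> i) u))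
                  \<le> ennreal (\<gamma>\<^sub>3 * \<kappa>\<^sub>1 * exp (- \<gamma>\<^sub>4 * of_int (k - j - 1))))))) \<and>
        (stationary M p Y \<and>
         (\<exists>D\<^sub>2. (SUP u\<in>vecs p. ennreal (spectral_norm p (H u))) < ennreal D\<^sub>2) \<longrightarrow>
           sup_psi2 M p (unit_sphere p) Y < \<infinity> \<and> sup_psi2 M p (sign_vectors p) Y < \<infinity>)"
\<comment> \<open>Each 2 is that of the triangle inequality at time \<open>j\<close>; the same
  \<open>coupled_space\<close> and \<open>copy j\<close> witness both conditions.\<close>
proof (rule exI[of _ 2], rule conjI[OF zero_less_numeral], rule exI[of _ 2], rule conjI[OF zero_less_numeral],
    intro allI impI, goal_cases)
  case (1 M p A H E Y a\<^sub>1 a\<^sub>2 \<kappa>\<^sub>1' \<kappa>\<^sub>s')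
  interpret nonlinear_ar M p A H E Y a\<^sub>1 a\<^sub>2 \<kappa>\<^sub>1' \<kappa>\<^sub>s' by (rule 1)
  have q: "1 \<le> 1 + \<epsilon>" "1 + \<epsilon> \<le> 5" using assms by auto
  show ?case
  proof (intro conjI[of "_ \<longrightarrow> _"] impI, goal_cases)
    case 1
    note bounds = coupling_bounds[OF q conjunct1[OF 1] conjunct2[OF 1]]
    show ?case unfolding Let_def
    proof (intro conjI allI, goal_cases)
      case (1 j)
      show ?case by (intro exI[of _ coupled_space] exI[of _ "copy j"] conjI allI impI bounds)
    next
      case (2 j)
      show ?case by (intro exI[of _ coupled_space] exI[of _ "copy j"] conjI allI impI bounds)
    qed
  next
    case 2
    thus ?case using stationary_sup_psi2_finite by blast
  qed
qed

end
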